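(* For any $\epsilon>0$, there is a two-sided adaptive algorithm for $\epsilon$-testing $s$-Sparse Polynomial with respect to the uniform distribution that makes $\tilde O(s^2/\epsilon)$ queries.
   Context: Boolean functions $f:\{0,1\}^n\to\{0,1\}$ are accessed through a membership-query oracle that returns $f(x)$ for a queried $x$. $f$ is $\epsilon$-far from a class $C$ (with respect to the uniform distribution) if $\Pr_{x}[f(x)\neq g(x)]\ge\epsilon$ for every $g\in C$, with $x$ uniform on $\{0,1\}^n$. A two-sided adaptive algorithm for $\epsilon$-testing $C$ is a randomized algorithm that, given $\epsilon$ and membership-query access to an arbitrary $f$ (and able to draw uniform random strings), chooses queries possibly adaptively, accepts with probability at least $2/3$ if $f\in C$, and rejects with probability at least $2/3$ if $f$ is $\epsilon$-far from every function in $C$. $\tilde O(T)$ means $O(T\cdot\mathrm{poly}(\log T))$. $s$-Sparse Polynomial is the class of functions that are sums over $\mathbb F_2$ of at most $s$ monotone terms (conjunctions of unnegated variables), of arbitrary degree. *)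

theory Defs
  imports "HOL-Probability.Probability" "HOL-Library.Z2"
begin

text \<open>Points of the Boolean cube are sequences of bits that vanish at all indices from n on.
  A Boolean function on the cube is represented by a function on all bit sequences, of which only
  the values on the cube matter.\<close>

definition cube :: "nat \<Rightarrow> (nat \<Rightarrow> bit) set" where
  "cube n = PiE_dflt {..<n} 0 (\<lambda>_. UNIV)"

lemma finite_UNIV_bit [simp]: "finite (UNIV :: bit set)"
proof -
  have "(UNIV :: bit set) = {0, 1}"
    by (auto intro: bit.exhaust)
  then show ?thesis
    by (metis finite.emptyI finite.insertI)
qed

lemma finite_cube [simp]: "finite (cube n)"
  unfolding cube_def by (rule finite_PiE_dflt) auto

lemma cube_nonempty [simp]: "cube n \<noteq> {}"
proof -
  have "(\<lambda>_. 0) \<in> cube n"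
    by (simp add: cube_def PiE_dflt_def)
  then show ?thesis by blast
qed

type_synonym boolfun = "(nat \<Rightarrow> bit) \<Rightarrow> bit"

text \<open>A monotone term is given by the set of its variables; the empty term is the constant 1,
  and the empty sum of terms is the constant 0.\<close>

definition monotone_term :: "nat set \<Rightarrow> boolfun" where
  "monotone_term T x = (\<Prod>i\<in>T. x i)"

definition sparse_polynomial :: "nat \<Rightarrow> nat \<Rightarrow> boolfun set" where
  "sparse_polynomial n s =
     {f. \<exists>M. M \<subseteq> Pow {..<n} \<and> card M \<le> s \<and> (\<forall>x\<in>cube n. f x = (\<Sum>T\<in>M. monotone_term T x))}"

definition eps_far :: "nat \<Rightarrow> real \<Rightarrow> boolfun set \<Rightarrow> boolfun \<Rightarrow> bool" where
  "eps_far n \<epsilon> C f \<longleftrightarrow>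
     (\<forall>g\<in>C. measure_pmf.prob (pmf_of_set (cube n)) {x. f x \<noteq> g x} \<ge> \<epsilon>)"

text \<open>Randomized adaptive query algorithms. Constructor \<open>Sample\<close> is a step of internal
  randomness: the algorithm draws its continuation, so drawing a uniform point and proceeding with
  \<open>k\<close> is \<open>Sample (map_pmf k (pmf_of_set (cube n)))\<close>. The continuation of a query depends
  on the oracle only through its answer.\<close>

datatype query_alg =
    Output bool
  | Query "nat \<Rightarrow> bit" "bit \<Rightarrow> query_alg"
  | Sample "query_alg pmf"

primrec run :: "boolfun \<Rightarrow> query_alg \<Rightarrow> bool pmf" where
  "run f (Output b) = return_pmf b"
| "run f (Query x k) = run f (k (f x))"
| "run f (Sample p) = join_pmf (map_pmf (run f) p)"

text \<open>All queries are points of the cube, and at most \<open>q\<close> of them are made on every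
  execution path. Sampling is free.\<close>

inductive query_bound :: "nat \<Rightarrow> nat \<Rightarrow> query_alg \<Rightarrow> bool" for n where
  "query_bound n q (Output b)"
| "x \<in> cube n \<Longrightarrow> (\<And>b. query_bound n q (k b)) \<Longrightarrow> query_bound n (Suc q) (Query x k)"
| "(\<And>a. a \<in> set_pmf p \<Longrightarrow> query_bound n q a) \<Longrightarrow> query_bound n q (Sample p)"

definition eps_tester :: "nat \<Rightarrow> real \<Rightarrow> boolfun set \<Rightarrow> query_alg \<Rightarrow> bool" where
  "eps_tester n \<epsilon> C A \<longleftrightarrow>
     (\<forall>f. (f \<in> C \<longrightarrow> pmf (run f A) True \<ge> 2/3) \<and>
          (eps_far n \<epsilon> C f \<longrightarrow> pmf (run f A) False \<ge> 2/3))"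

text \<open>The factor \<open>(1 + \<bar>ln T\<bar>) ^ k\<close> stands for a polynomial in the logarithm; unlike
  \<open>\<bar>ln T\<bar> ^ k\<close> it does not vanish at \<open>T = 1\<close>.\<close>

definition soft_O_on :: "'a set \<Rightarrow> ('a \<Rightarrow> real) \<Rightarrow> ('a \<Rightarrow> real) \<Rightarrow> bool" where
  "soft_O_on D q T \<longleftrightarrow>
     (\<exists>C k. \<forall>z\<in>D. q z \<le> C * T z * (1 + \<bar>ln (T z)\<bar>) ^ k)"

end

theory Submission
  imports Defs "HOL-Library.Function_Algebras"
begin

text \<open>Terms with more than logarithmically many variables are satisfied by none of the random sample
  points, nor by any point below a sample point. So if \<open>f\<close> is an \<open>s\<close>-sparse polynomial and every
  query lies below a sample point, then \<open>f\<close> behaves like a polynomial with \<open>K\<close> relevant variables,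
  \<open>K\<close> being \<open>s\<close> up to a logarithmic factor. A random hash separates them into blocks. Sampling
  points at which \<open>f\<close> changes when all blocks not yet found are zeroed, and binary search along the
  blocks, exhibits at most \<open>K\<close> relevant blocks, each with a witness \<open>v\<close>. The witness turns the block
  into a function \<open>h\<close> of one variable, which is checked by the linearity test of Blum, Luby and
  Rubinfeld together with a multiplicativity test. Since each \<open>h\<close> only needs to be
  \<open>O(\<epsilon> / K)\<close>-close to a coordinate, the values \<open>h x\<close> need no correction, and \<open>O(K / \<epsilon>)\<close> trials
  up to logarithmic factors suffice. Finally the tester accepts if some small polynomial in the values
  \<open>h\<^sub>1 x, \<dots>, h\<^sub>k x\<close> agrees with \<open>f\<close> on the sample: there are few such polynomials, and each of
  them is close to a sparse polynomial, from which \<open>f\<close> is far in the other case.\<close>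

declare add_bit_eq_xor [simp del] mult_bit_eq_and [simp del]

section \<open>Probability\<close>

lemma prob_eq_pmf_True: "measure_pmf.prob p S = pmf (map_pmf (\<lambda>x. x \<in> S) p) True"
  by (simp add: pmf_map vimage_def)

lemma prob_mono:
  assumes "\<And>x. x \<in> set_pmf p \<Longrightarrow> x \<in> A \<Longrightarrow> x \<in> B"
  shows "measure_pmf.prob p A \<le> measure_pmf.prob p B"
  by (rule measure_pmf.finite_measure_mono_AE) (auto simp: AE_measure_pmf_iff assms)

lemma prob_cong:
  assumes "\<And>x. x \<in> set_pmf p \<Longrightarrow> x \<in> A \<longleftrightarrow> x \<in> B"
  shows "measure_pmf.prob p A = measure_pmf.prob p B"
  by (intro antisym prob_mono) (auto simp: assms)

lemma prob_Un_le:
  "measure_pmf.prob p (A \<union> B) \<le> measure_pmf.prob p A + measure_pmf.prob p B"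
  by (rule measure_Un_le) auto

lemma prob_UN_le:
  assumes "finite I" and "\<And>i. i \<in> I \<Longrightarrow> measure_pmf.prob p (A i) \<le> b"
  shows "measure_pmf.prob p (\<Union>i\<in>I. A i) \<le> real (card I) * b"
proof -
  have "measure_pmf.prob p (\<Union>i\<in>I. A i) \<le> (\<Sum>i\<in>I. measure_pmf.prob p (A i))"
    by (rule measure_UNION_le) (use assms in auto)
  also have "\<dots> \<le> real (card I) * b"
    using sum_bounded_above[of I "\<lambda>i. measure_pmf.prob p (A i)" b] assms(2) by simp
  finally show ?thesis .
qed

lemma prob_bind:
  "measure_pmf.prob (bind_pmf p g) S = (\<integral>x. measure_pmf.prob (g x) S \<partial>measure_pmf p)"
  by (simp add: prob_eq_pmf_True map_bind_pmf pmf_bind)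

lemma integrable_prob: "integrable (measure_pmf p) (\<lambda>x. measure_pmf.prob (g x) S)"
  by (rule measure_pmf.integrable_const_bound[where B = 1]) auto

lemma integrable_indicator_pmf: "integrable (measure_pmf p) (indicator B :: 'a \<Rightarrow> real)"
  by (rule measure_pmf.integrable_const_bound[where B = 1]) auto

text \<open>Splits off an exceptional set \<open>B\<close> of outcomes of the first stage, for which
  the second stage is bounded by 1 only. The error estimates for the tester take this form, with the
  bad hash functions or bad samples as \<open>B\<close>.\<close>

lemma prob_bind_le:
  assumes "\<And>x. x \<in> set_pmf p \<Longrightarrow> x \<notin> B \<Longrightarrow> measure_pmf.prob (g x) S \<le> b" and "0 \<le> b"
  shows "measure_pmf.prob (bind_pmf p g) S \<le> measure_pmf.prob p B + b"
proof -
  have "measure_pmf.prob (bind_pmf p g) S \<le> (\<integral>x. indicator B x + b \<partial>measure_pmf p)"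
    unfolding prob_bind
  proof (rule integral_mono_AE)
    show "AE x in measure_pmf p. measure_pmf.prob (g x) S \<le> indicator B x + b"
      using assms by (auto simp: AE_measure_pmf_iff indicator_def add_increasing2)
  qed (auto intro: integrable_prob integrable_indicator_pmf)
  also have "\<dots> = measure_pmf.prob p B + b"
    by (simp add: Bochner_Integration.integral_add integrable_indicator_pmf)
  finally show ?thesis .
qed

lemma prob_bind_ge:
  assumes "\<And>x. x \<in> set_pmf p \<Longrightarrow> x \<in> B \<Longrightarrow> b \<le> measure_pmf.prob (g x) S"
  shows "b * measure_pmf.prob p B \<le> measure_pmf.prob (bind_pmf p g) S"
proof -
  have "b * measure_pmf.prob p B = (\<integral>x. b * indicator B x \<partial>measure_pmf p)"
    by simp
  also have "\<dots> \<le> measure_pmf.prob (bind_pmf p g) S"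
    unfolding prob_bind
  proof (rule integral_mono_AE)
    show "AE x in measure_pmf p. b * indicator B x \<le> measure_pmf.prob (g x) S"
      using assms by (auto simp: AE_measure_pmf_iff indicator_def)
  qed (auto intro: integrable_prob integrable_indicator_pmf)
  finally show ?thesis .
qed

lemma prob_map: "measure_pmf.prob (map_pmf f p) S = measure_pmf.prob p {x. f x \<in> S}"
  by (simp add: vimage_def)

lemma pair_pmf_bind: "pair_pmf p q = bind_pmf p (\<lambda>x. map_pmf (Pair x) q)"
  by (simp add: pair_pmf_def map_pmf_def)

lemma prob_pair_ge:
  assumes "\<And>x. x \<in> set_pmf p \<Longrightarrow> x \<in> B \<Longrightarrow> b \<le> measure_pmf.prob q {y. (x, y) \<in> S}"
  shows "b * measure_pmf.prob p B \<le> measure_pmf.prob (pair_pmf p q) S"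
  unfolding pair_pmf_bind 
proof (rule prob_bind_ge)
  fix x assume "x \<in> set_pmf p" "x \<in> B"
  then show "b \<le> measure_pmf.prob (map_pmf (Pair x) q) S"
    unfolding prob_map by (rule assms)
qed

lemma prob_pair_le:
  assumes "\<And>x. x \<in> set_pmf p \<Longrightarrow> measure_pmf.prob q {y. (x, y) \<in> S} \<le> b" and "0 \<le> b"
  shows "measure_pmf.prob (pair_pmf p q) S \<le> b"
proof -
  have "measure_pmf.prob (pair_pmf p q) S \<le> measure_pmf.prob p {} + b"
    unfolding pair_pmf_bind
  proof (rule prob_bind_le)
    fix x assume "x \<in> set_pmf p"
    then show "measure_pmf.prob (map_pmf (Pair x) q) S \<le> b"
      unfolding prob_map by (rule assms)
  qed (rule assms)
  then show ?thesis by simp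
qed

lemma prob_pair_fst: "measure_pmf.prob (pair_pmf p q) {z. fst z \<in> S} = measure_pmf.prob p S"
  using prob_map[of fst "pair_pmf p q" S] by (simp add: map_fst_pair_pmf)

lemma prob_pair_snd: "measure_pmf.prob (pair_pmf p q) {z. snd z \<in> S} = measure_pmf.prob q S"
  using prob_map[of snd "pair_pmf p q" S] by (simp add: map_snd_pair_pmf)

lemma prob_pair_Times:
  "measure_pmf.prob (pair_pmf p q) (A \<times> B) = measure_pmf.prob p A * measure_pmf.prob q B"
proof -
  have "measure_pmf.prob (pair_pmf p q) (A \<times> B) =
    (\<integral>x. indicator A x * measure_pmf.prob q B \<partial>measure_pmf p)"
    unfolding pair_pmf_bind prob_bind prob_map
    by (rule Bochner_Integration.integral_cong) (auto simp: indicator_def)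
  also have "\<dots> = measure_pmf.prob p A * measure_pmf.prob q B"
    by simp
  finally show ?thesis .
qed

lemma prob_replicate_all:
  "measure_pmf.prob (replicate_pmf N p) {xs. \<forall>x\<in>set xs. x \<in> S} = measure_pmf.prob p S ^ N"
proof (induction N)
  case (Suc N)
  have "replicate_pmf (Suc N) p = map_pmf (\<lambda>(x, xs). x # xs) (pair_pmf p (replicate_pmf N p))"
    by (simp add: pair_pmf_def map_bind_pmf)
  moreover have "{z :: 'a \<times> 'a list. (case z of (x, xs) \<Rightarrow> x # xs) \<in> {xs. \<forall>x\<in>set xs. x \<in> S}} =
    S \<times> {xs. \<forall>x\<in>set xs. x \<in> S}"
    by auto
  ultimately show ?case
    by (simp only: prob_map prob_pair_Times Suc power_Suc)
qed (simp add: indicator_def)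

lemma prob_replicate_ex:
  "measure_pmf.prob (replicate_pmf N p) {xs. \<exists>x\<in>set xs. x \<in> S} \<le> real N * measure_pmf.prob p S"
proof (induction N)
  case (Suc N)
  have eq: "replicate_pmf (Suc N) p = map_pmf (\<lambda>(x, xs). x # xs) (pair_pmf p (replicate_pmf N p))"
    by (simp add: pair_pmf_def map_bind_pmf)
  have "measure_pmf.prob (replicate_pmf (Suc N) p) {xs. \<exists>x\<in>set xs. x \<in> S} =
    measure_pmf.prob (pair_pmf p (replicate_pmf N p))
      ({z. fst z \<in> S} \<union> {z. snd z \<in> {xs. \<exists>x\<in>set xs. x \<in> S}})"
    unfolding eq prob_map by (rule arg_cong) auto
  also have "\<dots> \<le> measure_pmf.prob p S + real N * measure_pmf.prob p S"
    by (rule order_trans[OF prob_Un_le], unfold prob_pair_fst prob_pair_snd)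
      (intro add_mono order_refl Suc)
  finally show ?case
    by (simp add: algebra_simps)
qed (simp add: indicator_def)

section \<open>Testing for coordinate functions\<close>

lemma in_cube_iff: "x \<in> cube n \<longleftrightarrow> (\<forall>i\<ge>n. x i = 0)"
  by (auto simp: cube_def PiE_dflt_def)

abbreviation unif :: "nat \<Rightarrow> (nat \<Rightarrow> bit) pmf" where
  "unif n \<equiv> pmf_of_set (cube n)"

lemma set_unif [simp]: "set_pmf (unif n) = cube n"
  by (simp add: set_pmf_of_set)

lemma plus_in_cube [intro]: "x \<in> cube n \<Longrightarrow> y \<in> cube n \<Longrightarrow> x + y \<in> cube n"
  by (simp add: in_cube_iff)

lemma times_in_cube [intro]: "x \<in> cube n \<Longrightarrow> x * y \<in> cube n"
  by (simp add: in_cube_iff)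

lemma bit_add_self [simp]: "(a :: bit) + a = 0"
  by (cases a) simp_all

lemma bitvec_add_self [simp]: "(x :: nat \<Rightarrow> bit) + x = 0"
  by (rule ext) simp

lemma bitvec_add_cancel [simp]: "(x :: nat \<Rightarrow> bit) + (x + y) = y"
  by (simp add: add.assoc[symmetric])

lemma map_plus_unif:
  assumes "a \<in> cube n"
  shows "map_pmf ((+) a) (unif n) = unif n"
proof (rule map_pmf_of_set_bij_betw)
  show "bij_betw ((+) a) (cube n) (cube n)"
    \<comment> \<open>In characteristic 2 a translation is its own inverse.\<close>
    by (rule bij_betwI[where g = "(+) a"]) (use assms in auto)
qed auto

lemma prob_translate:
  assumes "a \<in> cube n"
  shows "measure_pmf.prob (unif n) {x. P (a + x)} = measure_pmf.prob (unif n) {x. P x}"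
  using prob_map[of "(+) a" "unif n" "{x. P x}"] map_plus_unif[OF assms] by simp

lemma prob_translate_pair:
  assumes "a \<in> cube n" "b \<in> cube n"
  shows "measure_pmf.prob (pair_pmf (unif n) (unif n)) {(x, y). P (a + x) (b + y)} =
    measure_pmf.prob (pair_pmf (unif n) (unif n)) {(x, y). P x y}"
proof -
  have "map_pmf (\<lambda>(x, y). (a + x, b + y)) (pair_pmf (unif n) (unif n)) =
    pair_pmf (unif n) (unif n)"
    unfolding map_pair map_plus_unif[OF assms(1)] map_plus_unif[OF assms(2)] ..
  then show ?thesis
    using prob_map[of "\<lambda>(x, y). (a + x, b + y)" "pair_pmf (unif n) (unif n)" "{(x, y). P x y}"]
    by (simp add: case_prod_unfold)
qed

section \<open>Self-correction of almost linear functions\<close>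

text \<open>Majority vote over the estimates \<open>h (x + y) + h y\<close>, each of which would be
  the value at \<open>x\<close> if \<open>h\<close> were linear. A tie counts as 0.\<close>

definition self_correct :: "nat \<Rightarrow> boolfun \<Rightarrow> boolfun" where
  "self_correct n h x =
     (if measure_pmf.prob (unif n) {y. h (x + y) + h y = 1} > 1/2 then 1 else 0)"

lemma prob_self_correct_half:
  "measure_pmf.prob (unif n) {y. h (x + y) + h y \<noteq> self_correct n h x} \<le> 1/2"
proof (cases "self_correct n h x = 0")
  case True
  then show ?thesis
    by (auto simp: self_correct_def split: if_splits)
next
  case False
  have "{y. h (x + y) + h y \<noteq> self_correct n h x} = UNIV - {y. h (x + y) + h y = 1}"
    using False by auto
  then have "measure_pmf.prob (unif n) {y. h (x + y) + h y \<noteq> self_correct n h x} =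
      1 - measure_pmf.prob (unif n) {y. h (x + y) + h y = 1}"
    using measure_pmf.prob_compl[of "{y. h (x + y) + h y = 1}" "unif n"] by simp
  then show ?thesis
    using False by (auto simp: self_correct_def split: if_splits)
qed

lemma prob_compl': "measure_pmf.prob p {x. \<not> P x} = 1 - measure_pmf.prob p {x. P x}"
  using measure_pmf.prob_compl[of "{x. P x}" p] by (simp add: Compl_eq_Diff_UNIV[symmetric] Collect_neg_eq)

text \<open>If \<open>q\<close> is the probability of a minority vote, two independent votes disagree with probability
  \<open>2 * q * (1 - q)\<close>. If they do, then linearity fails at one of two random pairs with sum \<open>x + y + z\<close>.\<close>

lemma prob_self_correct:
  assumes x: "x \<in> cube n"
    and lin: "measure_pmf.prob (pair_pmf (unif n) (unif n)) {(x, y). h (x + y) \<noteq> h x + h y} \<le> d"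
  shows "measure_pmf.prob (unif n) {y. h (x + y) + h y \<noteq> self_correct n h x} \<le> 2 * d"
proof -
  let ?U = "unif n" and ?P = "pair_pmf (unif n) (unif n)"
  define A where "A = {y. h (x + y) + h y \<noteq> self_correct n h x}"
  define q where "q = measure_pmf.prob ?U A"
  have lin1: "measure_pmf.prob ?P {(y, z). h ((x + y) + z) \<noteq> h (x + y) + h z} \<le> d"
    using prob_translate_pair[OF x, of 0 "\<lambda>y z. h (y + z) \<noteq> h y + h z"] lin
    by (simp add: in_cube_iff)
  have lin2: "measure_pmf.prob ?P {(y, z). h (y + (x + z)) \<noteq> h y + h (x + z)} \<le> d"
    using prob_translate_pair[OF _ x, of 0 "\<lambda>y z. h (y + z) \<noteq> h y + h z"] lin
    by (simp add: in_cube_iff)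
  have "measure_pmf.prob ?P (A \<times> (- A) \<union> (- A) \<times> A) \<le>
    measure_pmf.prob ?P ({(y, z). h ((x + y) + z) \<noteq> h (x + y) + h z} \<union>
      {(y, z). h (y + (x + z)) \<noteq> h y + h (x + z)})"
  proof (rule prob_mono)
    fix w assume w: "w \<in> A \<times> (- A) \<union> (- A) \<times> A"
    obtain y z where yz: "w = (y, z)" by (cases w)
    have "h (x + y) + h y \<noteq> h (x + z) + h z"
      using w yz unfolding A_def by auto
    then have "h (x + y) + h z \<noteq> h y + h (x + z)"
      by (cases "h (x + y)"; cases "h y"; cases "h (x + z)"; cases "h z") simp_all
    moreover have "x + y + z = y + (x + z)"
      by (simp add: algebra_simps)
    ultimately show "w \<in> {(y, z). h ((x + y) + z) \<noteq> h (x + y) + h z} \<union>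
      {(y, z). h (y + (x + z)) \<noteq> h y + h (x + z)}"
      unfolding yz by (simp only: Un_iff mem_Collect_eq case_prod_conv) metis
  qed
  also have "\<dots> \<le> d + d"
    using prob_Un_le lin1 lin2 by (rule order_trans[OF _ add_mono])
  finally have "measure_pmf.prob ?P (A \<times> (- A) \<union> (- A) \<times> A) \<le> 2 * d"
    by simp
  moreover have "measure_pmf.prob ?P (A \<times> (- A) \<union> (- A) \<times> A) = q * (1 - q) + (1 - q) * q"
  proof -
    have "measure_pmf.prob ?P (A \<times> (- A) \<union> (- A) \<times> A) =
      measure_pmf.prob ?P (A \<times> (- A)) + measure_pmf.prob ?P ((- A) \<times> A)"
      by (rule measure_pmf.finite_measure_Union) auto
    moreover have "measure_pmf.prob ?U (- A) = 1 - q"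
      using prob_compl'[of ?U "\<lambda>x. x \<in> A"] by (simp add: q_def Collect_neg_eq)
    ultimately show ?thesis
      by (simp add: prob_pair_Times q_def)
  qed
  ultimately have "2 * (q * (1 - q)) \<le> 2 * d"
    by simp
  \<comment> \<open>The minority has weight \<open>q\<close> at most 1/2, so \<open>1 - q\<close> is
    at least 1/2 and \<open>q\<close> itself is bounded by the probability
    \<open>2 * (q * (1 - q))\<close> that two votes disagree.\<close>
  moreover have "q * (1 - q) \<ge> q * (1/2)"
    using prob_self_correct_half[of n h x] unfolding q_def A_def
    by (intro mult_left_mono) auto
  ultimately show ?thesis
    unfolding q_def A_def by linarith
qed

lemma obtain_good_point:
  assumes "measure_pmf.prob p A < 1"
  obtains z where "z \<in> set_pmf p" "z \<notin> A"
  using assms measure_pmf.prob_eq_1[of A p] by (force simp: AE_measure_pmf_iff)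

text \<open>The votes for \<open>x\<close>, \<open>y\<close> and \<open>x + y\<close> fail with
  probability at most \<open>2 * d\<close> each, so some \<open>z\<close> makes all three correct at
  once. The vote for \<open>y\<close> is taken at \<open>x + z\<close> instead of \<open>z\<close>;
  then \<open>h (x + z)\<close> cancels in the sum.\<close>

lemma self_correct_add:
  assumes x: "x \<in> cube n" and y: "y \<in> cube n"
    and lin: "measure_pmf.prob (pair_pmf (unif n) (unif n)) {(x, y). h (x + y) \<noteq> h x + h y} \<le> d"
    and d: "6 * d < 1"
  shows "self_correct n h (x + y) = self_correct n h x + self_correct n h y"
proof -
  let ?g = "self_correct n h"
  have "measure_pmf.prob (unif n) {z. h (y + (x + z)) + h (x + z) \<noteq> ?g y} \<le> 2 * d"
    by (rule order_trans[OF eq_refl prob_self_correct[where h = h, OF y lin]])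
      (rule prob_translate[OF x, of "\<lambda>z. h (y + z) + h z \<noteq> ?g y"])
  then have "measure_pmf.prob (unif n)
     (({z. h (x + z) + h z \<noteq> ?g x} \<union> {z. h (y + (x + z)) + h (x + z) \<noteq> ?g y}) \<union>
      {z. h ((x + y) + z) + h z \<noteq> ?g (x + y)}) \<le> 2 * d + 2 * d + 2 * d"
    using prob_self_correct[where h = h, OF x lin] prob_self_correct[where h = h, OF plus_in_cube[OF x y] lin]
    by (intro order_trans[OF prob_Un_le] add_mono) auto
  then have "measure_pmf.prob (unif n)
     (({z. h (x + z) + h z \<noteq> ?g x} \<union> {z. h (y + (x + z)) + h (x + z) \<noteq> ?g y}) \<union>
      {z. h ((x + y) + z) + h z \<noteq> ?g (x + y)}) < 1"
    using d by linarith
  then obtain z where z: "h (x + z) + h z = ?g x" "h (y + (x + z)) + h (x + z) = ?g y"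
    "h ((x + y) + z) + h z = ?g (x + y)"
    by (rule obtain_good_point) blast
  have "y + (x + z) = (x + y) + z"
    by (simp add: algebra_simps)
  then show ?thesis
    using z by (cases "h (x + z)"; cases "h z"; cases "h (x + y + z)") auto
qed

text \<open>Where \<open>h x\<close> differs from the majority, at least half of the
  \<open>y\<close> vote against \<open>h x\<close>, and each of them violates linearity at
  \<open>(x, y)\<close>.\<close>

lemma prob_self_correct_neq:
  assumes lin: "measure_pmf.prob (pair_pmf (unif n) (unif n)) {(x, y). h (x + y) \<noteq> h x + h y} \<le> d"
  shows "measure_pmf.prob (unif n) {x. h x \<noteq> self_correct n h x} \<le> 2 * d"
proof -
  have "1/2 * measure_pmf.prob (unif n) {x. h x \<noteq> self_correct n h x} \<le>
    measure_pmf.prob (pair_pmf (unif n) (unif n)) {(x, y). h (x + y) \<noteq> h x + h y}"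
  proof (rule prob_pair_ge)
    fix x assume x: "x \<in> set_pmf (unif n)" "x \<in> {x. h x \<noteq> self_correct n h x}"
    have "1/2 \<le> 1 - measure_pmf.prob (unif n) {y. h (x + y) + h y \<noteq> self_correct n h x}"
      using prob_self_correct_half[of n h x] by simp
    also have "\<dots> = measure_pmf.prob (unif n) {y. \<not> (h (x + y) + h y \<noteq> self_correct n h x)}"
      by (rule prob_compl'[symmetric])
    also have "\<dots> \<le> measure_pmf.prob (unif n) {y. (x, y) \<in> {(x, y). h (x + y) \<noteq> h x + h y}}"
    proof (rule prob_mono)
      fix y assume "y \<in> {y. \<not> (h (x + y) + h y \<noteq> self_correct n h x)}"
      then show "y \<in> {y. (x, y) \<in> {(x, y). h (x + y) \<noteq> h x + h y}}"
        using x(2) by (cases "h (x + y)"; cases "h y"; cases "h x") auto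
    qed
    finally show "1/2 \<le> \<dots>" .
  qed
  then show ?thesis
    using lin by linarith
qed

section \<open>Additive functions and coordinates\<close>

definition unit_bit :: "nat \<Rightarrow> nat \<Rightarrow> bit" where
  "unit_bit i = (\<lambda>j. if j = i then 1 else 0)"

lemma unit_bit_in_cube [simp]: "unit_bit i \<in> cube n \<longleftrightarrow> i < n"
  by (auto simp: in_cube_iff unit_bit_def)

definition coord_or_zero :: "nat option \<Rightarrow> boolfun" where
  "coord_or_zero c x = (case c of None \<Rightarrow> 0 | Some i \<Rightarrow> x i)"

lemma additive_eq_sum:
  assumes add: "\<And>x y. x \<in> cube n \<Longrightarrow> y \<in> cube n \<Longrightarrow> g (x + y) = g x + (g y :: bit)"
    and x: "x \<in> cube n"
  shows "g x = (\<Sum>i<n. x i * g (unit_bit i))"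
proof -
  have g0: "g 0 = 0"
    using add[of 0 0] by (simp add: in_cube_iff)
  have "g (\<lambda>i. if i < m then x i else 0) = (\<Sum>i<m. x i * g (unit_bit i))" if "m \<le> n" for m
    using that
  proof (induction m)
    case 0
    then show ?case using g0 by (simp add: zero_fun_def)
  next
    case (Suc m)
    show ?case
    proof (cases "x m = 0")
      case True
      then have "(\<lambda>i. if i < Suc m then x i else 0) = (\<lambda>i. if i < m then x i else 0)"
        by (auto simp: less_Suc_eq)
      then show ?thesis using True Suc by simp
    next
      case False
      then have "(\<lambda>i. if i < Suc m then x i else 0) = (\<lambda>i. if i < m then x i else 0) + unit_bit m"
        by (auto simp: less_Suc_eq unit_bit_def)
      moreover have "(\<lambda>i. if i < m then x i else 0) \<in> cube n"
        using x by (auto simp: in_cube_iff)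
      ultimately show ?thesis using False Suc by (simp add: add)
    qed
  qed
  from this[of n] have "g (\<lambda>i. if i < n then x i else 0) = (\<Sum>i<n. x i * g (unit_bit i))"
    by simp
  moreover have "(\<lambda>i. if i < n then x i else 0) = x"
    using x by (auto simp: in_cube_iff)
  ultimately show ?thesis by simp
qed

lemma additive_coord_or_zero:
  assumes add: "\<And>x y. x \<in> cube n \<Longrightarrow> y \<in> cube n \<Longrightarrow> g (x + y) = g x + (g y :: bit)"
    and uniq: "\<And>i j. i < n \<Longrightarrow> j < n \<Longrightarrow> g (unit_bit i) = 1 \<Longrightarrow> g (unit_bit j) = 1 \<Longrightarrow> i = j"
  obtains c where "set_option c \<subseteq> {..<n}" "\<And>x. x \<in> cube n \<Longrightarrow> g x = coord_or_zero c x"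
proof (cases "\<exists>i<n. g (unit_bit i) = 1")
  case True
  then obtain i where i: "i < n" "g (unit_bit i) = 1" by blast
  have "g x = coord_or_zero (Some i) x" if "x \<in> cube n" for x
  proof -
    have "g x = (\<Sum>j<n. x j * g (unit_bit j))"
      using additive_eq_sum[of n g] add that by blast
    also have "\<dots> = (\<Sum>j<n. if j = i then x i else 0)"
    proof (intro sum.cong refl)
      fix j assume "j \<in> {..<n}"
      then have "j \<noteq> i \<Longrightarrow> g (unit_bit j) = 0"
        using uniq i by (metis bit_not_one_iff lessThan_iff)
      then show "x j * g (unit_bit j) = (if j = i then x i else 0)"
        using i by auto
    qed
    also have "\<dots> = x i" using i by simp
    finally show ?thesis by (simp add: coord_or_zero_def)
  qed
  then show ?thesis using that[of "Some i"] i by simp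
next
  case False
  have "g x = coord_or_zero None x" if "x \<in> cube n" for x
  proof -
    have "g x = (\<Sum>j<n. x j * g (unit_bit j))"
      using additive_eq_sum[of n g] add that by blast
    also have "\<dots> = 0" using False by (intro sum.neutral) auto
    finally show ?thesis by (simp add: coord_or_zero_def)
  qed
  then show ?thesis using that[of None] by simp
qed

section \<open>The coordinate test and its soundness\<close>

text \<open>Coordinates are the nonzero functions that respect both sum and product. The product
  \<open>x * y\<close> is not uniformly distributed, and \<open>h\<close> might be wrong just on
  such points; shifting by a random \<open>w\<close> reads off the self-corrected value
  there.\<close>

definition coord_test :: "boolfun \<Rightarrow> (nat \<Rightarrow> bit) \<times> (nat \<Rightarrow> bit) \<times> (nat \<Rightarrow> bit) \<Rightarrow> bool" where
  "coord_test h = (\<lambda>(x, y, w). h (x + y) = h x + h y \<and> h (w + x * y) = h w + h x * h y)"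

abbreviation trial :: "nat \<Rightarrow> ((nat \<Rightarrow> bit) \<times> (nat \<Rightarrow> bit) \<times> (nat \<Rightarrow> bit)) pmf" where
  "trial n \<equiv> pair_pmf (unif n) (pair_pmf (unif n) (unif n))"

lemma map_trial_12: "map_pmf (\<lambda>(x, y, w). (x, y)) (trial n) = pair_pmf (unif n) (unif n)"
  using map_pair[of "\<lambda>x. x" fst "unif n" "pair_pmf (unif n) (unif n)"]
  by (simp add: map_fst_pair_pmf case_prod_unfold)

lemma prob_trial_12:
  "measure_pmf.prob (trial n) {(x, y, w). P x y} =
   measure_pmf.prob (pair_pmf (unif n) (unif n)) {(x, y). P x y}"
proof -
  have "measure_pmf.prob (pair_pmf (unif n) (unif n)) {(x, y). P x y} =
    measure_pmf.prob (map_pmf (\<lambda>(x, y, w). (x, y)) (trial n)) {(x, y). P x y}"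
    by (simp only: map_trial_12)
  also have "\<dots> = measure_pmf.prob (trial n) {(x, y, w). P x y}"
    unfolding prob_map by (rule arg_cong) auto
  finally show ?thesis ..
qed

lemma prob_trial_1:
  "measure_pmf.prob (trial n) {(x, y, w). P x} = measure_pmf.prob (unif n) {x. P x}"
  using prob_pair_fst[of "unif n" "pair_pmf (unif n) (unif n)" "{x. P x}"]
  by (simp add: case_prod_unfold)

lemma prob_trial_2:
  "measure_pmf.prob (trial n) {(x, y, w). P y} = measure_pmf.prob (unif n) {y. P y}"
  using prob_trial_12[of n "\<lambda>x y. P y"] prob_pair_snd[of "unif n" "unif n" "{x. P x}"]
  by (simp add: case_prod_unfold)

text \<open>For distinct \<open>i\<close>, \<open>j\<close> the bilinear form \<open>(x, y) \<mapsto> g (x * y) + g x * g y\<close> evaluated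
  at \<open>(unit_bit i, unit_bit j)\<close> is the sum of its values at four translates of a random pair. If it
  does not vanish there, it is nonzero with probability at least \<open>1/4\<close>.\<close>

lemma additive_multiplicative_unique:
  assumes add: "\<And>x y. x \<in> cube n \<Longrightarrow> y \<in> cube n \<Longrightarrow> g (x + y) = g x + (g y :: bit)"
    and mult: "measure_pmf.prob (pair_pmf (unif n) (unif n)) {(x, y). g (x * y) \<noteq> g x * g y} < 1/4"
    and ij: "i < n" "j < n" "g (unit_bit i) = 1" "g (unit_bit j) = 1"
  shows "i = j"
proof (rule ccontr)
  assume neq: "i \<noteq> j"
  let ?P = "pair_pmf (unif n) (unif n)" and ?a = "unit_bit i" and ?b = "unit_bit j"
  let ?Q = "\<lambda>x y. g (x * y) \<noteq> g x * g y"
  have g0: "g 0 = 0"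
    using add[of 0 0] by (simp add: in_cube_iff)
  have ab: "?a \<in> cube n" "?b \<in> cube n" using ij by auto
  have zero: "(0 :: nat \<Rightarrow> bit) \<in> cube n" by (simp add: in_cube_iff)
  have "1 = measure_pmf.prob ?P UNIV" by simp
  also have "\<dots> \<le> measure_pmf.prob ?P
    (({(x, y). ?Q (0 + x) (0 + y)} \<union> {(x, y). ?Q (?a + x) (0 + y)}) \<union>
     ({(x, y). ?Q (0 + x) (?b + y)} \<union> {(x, y). ?Q (?a + x) (?b + y)}))"
  proof (rule prob_mono)
    fix z assume z: "z \<in> set_pmf ?P"
    then obtain x y where xy: "z = (x, y)" "x \<in> cube n" "y \<in> cube n" by auto
    have "?a * ?b = 0" using neq by (auto simp: unit_bit_def)
    then have g4: "g ((?a + x) * (?b + y)) = g (?a * y) + g (x * ?b) + g (x * y)"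
      using xy ab by (simp add: algebra_simps add times_in_cube plus_in_cube g0)
    have g2: "g ((?a + x) * y) = g (?a * y) + g (x * y)"
      using xy ab by (simp add: distrib_right add times_in_cube)
    have g3: "g (x * (?b + y)) = g (x * ?b) + g (x * y)"
      using xy ab by (simp add: distrib_left add times_in_cube)
    have "g (?a + x) = 1 + g x" "g (?b + y) = 1 + g y"
      using add xy ab ij by auto
    then have "?Q x y \<or> ?Q (?a + x) y \<or> ?Q x (?b + y) \<or> ?Q (?a + x) (?b + y)"
      unfolding g2 g3 g4
      by (cases "g x"; cases "g y"; cases "g (x * y)"; cases "g (?a * y)"; cases "g (x * ?b)") simp_all
    then show "z \<in> ({(x, y). ?Q (0 + x) (0 + y)} \<union> {(x, y). ?Q (?a + x) (0 + y)}) \<union>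
     ({(x, y). ?Q (0 + x) (?b + y)} \<union> {(x, y). ?Q (?a + x) (?b + y)})"
      using xy by auto
  qed
  also have "\<dots> \<le> (measure_pmf.prob ?P {(x, y). ?Q (0 + x) (0 + y)} +
      measure_pmf.prob ?P {(x, y). ?Q (?a + x) (0 + y)}) +
     (measure_pmf.prob ?P {(x, y). ?Q (0 + x) (?b + y)} +
      measure_pmf.prob ?P {(x, y). ?Q (?a + x) (?b + y)})"
    by (intro order_trans[OF prob_Un_le] add_mono order_refl)
  also have "\<dots> < 1"
    using mult prob_translate_pair[OF zero zero, of ?Q] prob_translate_pair[OF ab(1) zero, of ?Q]
      prob_translate_pair[OF zero ab(2), of ?Q] prob_translate_pair[OF ab(1,2), of ?Q]
    by linarith
  finally show False by simp
qed

text \<open>The corrected function is exactly additive. It is multiplicative up to probability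
  \<open>7 * d\<close>: \<open>d\<close> for the test, \<open>2 * d\<close> for the vote at
  \<open>x * y\<close>, and \<open>2 * d\<close> each for correcting \<open>h x\<close> and
  \<open>h y\<close>. This has to stay below 1/4, whence the constant 28.\<close>

lemma coord_test_sound:
  assumes test: "measure_pmf.prob (trial n) {t. \<not> coord_test h t} \<le> d" and d: "28 * d < 1"
  obtains c where "set_option c \<subseteq> {..<n}"
    "measure_pmf.prob (unif n) {x. h x \<noteq> coord_or_zero c x} \<le> 2 * d"
proof -
  let ?P = "pair_pmf (unif n) (unif n)" and ?g = "self_correct n h"
  have "measure_pmf.prob (trial n) {(x, y, w). h (x + y) \<noteq> h x + h y} \<le> d"
    by (rule order_trans[OF prob_mono test]) (auto simp: coord_test_def)
  then have lin: "measure_pmf.prob ?P {(x, y). h (x + y) \<noteq> h x + h y} \<le> d"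
    by (simp add: prob_trial_12)
  have d0: "0 \<le> d"
    using lin measure_nonneg by (rule order_trans[rotated])
  have add: "?g (x + y) = ?g x + ?g y" if "x \<in> cube n" "y \<in> cube n" for x y
    using self_correct_add[OF that lin] d d0 by linarith
  have neq: "measure_pmf.prob (unif n) {x. h x \<noteq> ?g x} \<le> 2 * d"
    by (rule prob_self_correct_neq[OF lin])
  \<comment> \<open>For fixed \<open>x\<close> and \<open>y\<close> the shift \<open>w\<close> is
    still uniform, so the bound on the vote applies at the point \<open>x * y\<close>.\<close>
  have corr: "measure_pmf.prob (trial n) {(x, y, w). h (x * y + w) + h w \<noteq> ?g (x * y)} \<le> 2 * d"
  proof (rule prob_pair_le)
    fix x assume "x \<in> set_pmf (unif n)"
    show "measure_pmf.prob ?P {z. (x, z) \<in> {(x, y, w). h (x * y + w) + h w \<noteq> ?g (x * y)}} \<le> 2 * d"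
    proof (rule prob_pair_le)
      fix y assume "y \<in> set_pmf (unif n)"
      then have "x * y \<in> cube n" using \<open>x \<in> set_pmf (unif n)\<close> by auto
      then show "measure_pmf.prob (unif n) {w. (y, w) \<in> {z. (x, z) \<in>
          {(x, y, w). h (x * y + w) + h w \<noteq> ?g (x * y)}}} \<le> 2 * d"
        using prob_self_correct[where h = h, OF _ lin, of "x * y"] by (simp only: mem_Collect_eq case_prod_conv)
    qed (use d0 in auto)
  qed (use d0 in auto)
  have "measure_pmf.prob ?P {(x, y). ?g (x * y) \<noteq> ?g x * ?g y} =
    measure_pmf.prob (trial n) {(x, y, w). ?g (x * y) \<noteq> ?g x * ?g y}"
    by (rule prob_trial_12[symmetric])
  also have "\<dots> \<le> measure_pmf.prob (trial n)
    (({t. \<not> coord_test h t} \<union> {(x, y, w). h (x * y + w) + h w \<noteq> ?g (x * y)}) \<union>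
     ({(x, y, w). h x \<noteq> ?g x} \<union> {(x, y, w). h y \<noteq> ?g y}))"
    by (rule prob_mono) (auto simp: coord_test_def add.commute)
  also have "\<dots> \<le> (d + 2 * d) + (2 * d + 2 * d)"
    using test corr neq by (intro order_trans[OF prob_Un_le] add_mono) (auto simp: prob_trial_1 prob_trial_2)
  also have "\<dots> < 1/4" using d by simp
  finally have mult: "measure_pmf.prob ?P {(x, y). ?g (x * y) \<noteq> ?g x * ?g y} < 1/4" .
  obtain c where c: "set_option c \<subseteq> {..<n}" "\<And>x. x \<in> cube n \<Longrightarrow> ?g x = coord_or_zero c x"
    using additive_coord_or_zero[of n ?g] additive_multiplicative_unique[of n ?g] add mult by blast
  have "measure_pmf.prob (unif n) {x. h x \<noteq> coord_or_zero c x} \<le> measure_pmf.prob (unif n) {x. h x \<noteq> ?g x}"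
    by (rule prob_mono) (use c in auto)
  then show ?thesis
    using that c neq by (meson order_trans)
qed

section \<open>The tester\<close>

text \<open>The answers are recorded in \<open>g\<close>, which the continuation evaluates in place
  of the oracle.\<close>

primrec ask_all :: "(nat \<Rightarrow> bit) list \<Rightarrow> boolfun \<Rightarrow> (boolfun \<Rightarrow> query_alg) \<Rightarrow> query_alg" where
  "ask_all [] g k = k g"
| "ask_all (x # xs) g k = Query x (\<lambda>b. ask_all xs (g(x := b)) k)"

primrec bsearch ::
  "(nat \<Rightarrow> nat \<Rightarrow> bit) \<Rightarrow> bit \<Rightarrow> nat \<Rightarrow> nat \<Rightarrow> (nat \<Rightarrow> query_alg) \<Rightarrow> query_alg" where
  "bsearch w a 0 l k = k l"
| "bsearch w a (Suc d) l k = Query (w (l + 2 ^ d)) (\<lambda>b. bsearch w a d (if b = a then l + 2 ^ d else l) k)"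

lemma run_ask_all: "run f (ask_all xs g k) = run f (k (\<lambda>x. if x \<in> set xs then f x else g x))"
proof (induction xs arbitrary: g)
  case (Cons a xs)
  have "(\<lambda>x. if x \<in> set xs then f x else (g(a := f a)) x) =
    (\<lambda>x. if x \<in> set (a # xs) then f x else g x)"
    by auto
  then show ?case by (simp only: ask_all.simps run.simps Cons)
qed simp

lemma query_bound_ask_all:
  assumes "set xs \<subseteq> cube n" and "\<And>g. query_bound n q (k g)"
  shows "query_bound n (length xs + q) (ask_all xs g k)"
  using assms by (induction xs arbitrary: g) (auto intro: query_bound.intros)

text \<open>The invariant is value \<open>a\<close> at the left end \<open>l\<close> and another
  value at the right end \<open>l + 2 ^ d\<close>; at length 1 the ends are \<open>m\<close> and
  \<open>Suc m\<close>. The first half is unconditional, since soundness has to follow the run on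
  arbitrary \<open>f\<close>.\<close>

lemma run_bsearch:
  "\<exists>m. run f (bsearch w a d l k) = run f (k m) \<and>
     (f (w l) = a \<longrightarrow> f (w (l + 2 ^ d)) \<noteq> a \<longrightarrow> f (w m) = a \<and> f (w (Suc m)) \<noteq> a)"
proof (induction d arbitrary: l)
  case (Suc d)
  show ?case
    using Suc[of l] Suc[of "l + 2 ^ d"] by (cases "f (w (l + 2 ^ d)) = a") (auto simp: mult_2 add.assoc)
qed auto

lemma query_bound_bsearch:
  assumes "\<And>m. w m \<in> cube n" and "\<And>m. query_bound n q (k m)"
  shows "query_bound n (d + q) (bsearch w a d l k)"
  using assms by (induction d arbitrary: l) (auto intro: query_bound.intros)

lemma query_bound_mono: "query_bound n q A \<Longrightarrow> q \<le> q' \<Longrightarrow> query_bound n q' A"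
proof (induction q A arbitrary: q' rule: query_bound.induct)
  case (2 x q k)
  then obtain q'' where "q' = Suc q''" "q \<le> q''"
    by (cases q') auto
  then show ?case using 2 by (auto intro: query_bound.intros)
qed (auto intro: query_bound.intros)

text \<open>A hash function \<open>c\<close> partitions the variables into blocks. The state of the tester is a list
  of pairs \<open>(b, v)\<close> of a block \<open>b\<close> and a witness \<open>v\<close> to the relevance of \<open>b\<close>: zeroing the block
  \<open>b\<close> changes the value at \<open>v\<close>.\<close>

type_synonym state = "(nat \<times> (nat \<Rightarrow> bit)) list"

definition keep :: "(nat \<Rightarrow> nat) \<Rightarrow> nat set \<Rightarrow> (nat \<Rightarrow> bit) \<Rightarrow> nat \<Rightarrow> bit" where
  "keep c B x = (\<lambda>i. if c i \<in> B then x i else 0)"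

text \<open>Inserting \<open>v * y\<close> rather than \<open>y\<close> into block \<open>b\<close> keeps the query below \<open>v\<close>, so that no
  term is satisfied that is not already satisfied by \<open>v\<close>.\<close>

definition mix :: "(nat \<Rightarrow> nat) \<Rightarrow> nat \<Rightarrow> (nat \<Rightarrow> bit) \<Rightarrow> (nat \<Rightarrow> bit) \<Rightarrow> nat \<Rightarrow> bit" where
  "mix c b v y = (\<lambda>i. if c i = b then v i * y i else v i)"

text \<open>Adding the value at 0 normalises the response to vanish at 0, so that it can be a
  coordinate but not the negation of one.\<close>

definition response :: "boolfun \<Rightarrow> (nat \<Rightarrow> nat) \<Rightarrow> nat \<times> (nat \<Rightarrow> bit) \<Rightarrow> boolfun" where
  "response f c = (\<lambda>(b, v) y. f (mix c b v y) + f (mix c b v 0))"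

text \<open>Candidate polynomials over the two-element field in \<open>k\<close> variables, each
  encoded as the set of its terms.\<close>

definition small_polys :: "nat \<Rightarrow> nat \<Rightarrow> nat \<Rightarrow> nat set set set" where
  "small_polys k r s = {M. M \<subseteq> {I. I \<subseteq> {..<k} \<and> card I \<le> r} \<and> card M \<le> s}"

type_synonym trials = "((nat \<Rightarrow> bit) \<times> (nat \<Rightarrow> bit) \<times> (nat \<Rightarrow> bit)) list"

text \<open>The same sample serves for the coordinate tests and, through its first components, for
  the comparison with the candidates. The two uses are estimated in separate cases, so their
  dependence does no harm.\<close>

definition accepts :: "boolfun \<Rightarrow> (nat \<Rightarrow> nat) \<Rightarrow> nat \<Rightarrow> nat \<Rightarrow> state \<Rightarrow> trials \<Rightarrow> bool" where
  "accepts f c r s \<sigma> \<rho> \<longleftrightarrow>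
     (\<forall>bv\<in>set \<sigma>. \<forall>t\<in>set \<rho>. coord_test (response f c bv) t) \<and>
     (\<exists>M\<in>small_polys (length \<sigma>) r s. \<forall>t\<in>set \<rho>.
        f (fst t) = (\<Sum>I\<in>M. monotone_term I (\<lambda>i. response f c (\<sigma> ! i) (fst t))))"

definition agreement_points :: "(nat \<Rightarrow> nat) \<Rightarrow> state \<Rightarrow> trials \<Rightarrow> (nat \<Rightarrow> bit) list" where
  "agreement_points c \<sigma> \<rho> = map fst \<rho> @ map (\<lambda>t. keep c (fst ` set \<sigma>) (fst t)) \<rho>"

definition trial_points ::
  "(nat \<Rightarrow> bit) \<times> (nat \<Rightarrow> bit) \<times> (nat \<Rightarrow> bit) \<Rightarrow> (nat \<Rightarrow> bit) list" where
  "trial_points = (\<lambda>(x, y, w). [x, y, x + y, w, w + x * y])"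

definition test_points :: "(nat \<Rightarrow> nat) \<Rightarrow> state \<Rightarrow> trials \<Rightarrow> (nat \<Rightarrow> bit) list" where
  "test_points c \<sigma> \<rho> =
     concat (map (\<lambda>(b, v). map (mix c b v) (0 # concat (map trial_points \<rho>))) \<sigma>)"

text \<open>If zeroing the unknown blocks changes \<open>f\<close> at some sample point, the search
  restores blocks in order until the value changes. The witness for block \<open>m\<close> keeps the
  blocks up to and including \<open>m\<close>, so that zeroing \<open>m\<close> leads back to the
  preceding point of the search. If nothing changes, the run ends with a verdict.\<close>

definition epoch ::
  "(nat \<Rightarrow> nat) \<Rightarrow> nat \<Rightarrow> nat \<Rightarrow> state \<Rightarrow> trials \<Rightarrow> (state \<Rightarrow> query_alg) \<Rightarrow> query_alg" where
  "epoch c r s \<sigma> \<rho> k =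
     (let B = fst ` set \<sigma> in
      ask_all (agreement_points c \<sigma> \<rho>) (\<lambda>_. 0) (\<lambda>g.
        case find (\<lambda>t. g (fst t) \<noteq> g (keep c B (fst t))) \<rho> of
          Some t \<Rightarrow>
            bsearch (\<lambda>m. keep c (B \<union> {..<m}) (fst t)) (g (keep c B (fst t))) r 0
              (\<lambda>m. k ((m, keep c (B \<union> {..<Suc m}) (fst t)) # \<sigma>))
        | None \<Rightarrow> ask_all (test_points c \<sigma> \<rho>) g (\<lambda>g. Output (accepts g c r s \<sigma> \<rho>))))"

text \<open>Each epoch draws fresh trials, so that they are independent of the state. When the
  epochs run out, more blocks have been found than a sparse polynomial is expected to have, hence
  the rejection.\<close>

primrec epochs ::
  "nat \<Rightarrow> (nat \<Rightarrow> nat) \<Rightarrow> nat \<Rightarrow> nat \<Rightarrow> nat \<Rightarrow> nat \<Rightarrow> state \<Rightarrow> query_alg" where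
  "epochs n c r s N 0 = (\<lambda>\<sigma>. Output False)"
| "epochs n c r s N (Suc e) =
     (\<lambda>\<sigma>. Sample (map_pmf (\<lambda>\<rho>. epoch c r s \<sigma> \<rho> (epochs n c r s N e)) (replicate_pmf N (trial n))))"

section \<open>The course of one epoch\<close>

lemma run_Sample_map: "run f (Sample (map_pmf k p)) = bind_pmf p (\<lambda>x. run f (k x))"
  by (simp add: bind_eq_join_pmf map_pmf_comp)

lemma mix_in_test_points:
  assumes "(b, v) \<in> set \<sigma>" "y \<in> insert 0 (\<Union>t\<in>set \<rho>. set (trial_points t))"
  shows "mix c b v y \<in> set (test_points c \<sigma> \<rho>)"
  using assms by (induction \<sigma>) (auto simp: test_points_def simp del: zero_fun_apply)

text \<open>The verdict depends on the oracle only at the queried points, so it may be computed from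
  the recorded answers.\<close>

lemma accepts_cong:
  assumes "\<And>y. y \<in> set (test_points c \<sigma> \<rho>) \<Longrightarrow> g y = f y"
    and "\<And>t. t \<in> set \<rho> \<Longrightarrow> g (fst t) = f (fst t)"
  shows "accepts g c r s \<sigma> \<rho> = accepts f c r s \<sigma> \<rho>"
proof -
  have "g (mix c b v y) = f (mix c b v y)"
    if "(b, v) \<in> set \<sigma>" "y \<in> insert 0 (\<Union>t\<in>set \<rho>. set (trial_points t))" for b v y
    by (rule assms(1), rule mix_in_test_points) (use that in auto)
  then have resp: "response g c bv y = response f c bv y"
    if "bv \<in> set \<sigma>" "t \<in> set \<rho>" "y \<in> set (trial_points t)" for bv t y
    using that by (cases bv) (auto simp: response_def)
  have test: "coord_test (response g c bv) t = coord_test (response f c bv) t"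
    if "bv \<in> set \<sigma>" "t \<in> set \<rho>" for bv t
    using resp[OF that] by (cases t) (simp add: coord_test_def trial_points_def)
  have poly: "(\<Sum>I\<in>M. monotone_term I (\<lambda>i. response g c (\<sigma> ! i) (fst t))) =
      (\<Sum>I\<in>M. monotone_term I (\<lambda>i. response f c (\<sigma> ! i) (fst t)))"
    if "M \<in> small_polys (length \<sigma>) r s" "t \<in> set \<rho>" for M t
  proof (rule sum.cong[OF refl])
    fix I assume "I \<in> M"
    then have "I \<subseteq> {..<length \<sigma>}" using that by (auto simp: small_polys_def)
    then show "monotone_term I (\<lambda>i. response g c (\<sigma> ! i) (fst t)) =
        monotone_term I (\<lambda>i. response f c (\<sigma> ! i) (fst t))"
      unfolding monotone_term_def using that resp[OF nth_mem that(2)]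
      by (cases t) (auto simp: trial_points_def intro!: prod.cong)
  qed
  show ?thesis
    unfolding accepts_def using test poly assms(2) by (simp cong: ball_cong bex_cong)
qed

lemma run_epoch_agree:
  assumes "\<And>t. t \<in> set \<rho> \<Longrightarrow> f (fst t) = f (keep c (fst ` set \<sigma>) (fst t))"
  shows "run f (epoch c r s \<sigma> \<rho> k) = return_pmf (accepts f c r s \<sigma> \<rho>)"
proof -
  define g where "g = (\<lambda>x. if x \<in> set (agreement_points c \<sigma> \<rho>) then f x else 0)"
  have g: "g (fst t) = f (fst t)" "g (keep c (fst ` set \<sigma>) (fst t)) = f (keep c (fst ` set \<sigma>) (fst t))"
    if "t \<in> set \<rho>" for t
    using that by (auto simp: g_def agreement_points_def)
  have ask: "run f (ask_all (agreement_points c \<sigma> \<rho>) (\<lambda>_. 0) k') = run f (k' g)" for k'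
    by (simp only: run_ask_all g_def)
  have "find (\<lambda>t. g (fst t) \<noteq> g (keep c (fst ` set \<sigma>) (fst t))) \<rho> = None"
    using g assms by (auto simp: find_None_iff)
  moreover have "accepts (\<lambda>x. if x \<in> set (test_points c \<sigma> \<rho>) then f x else g x) c r s \<sigma> \<rho> =
      accepts f c r s \<sigma> \<rho>"
    by (rule accepts_cong) (auto simp: g)
  ultimately show ?thesis
    unfolding epoch_def Let_def ask by (simp add: run_ask_all)
qed

text \<open>The premise of the last property makes the right end of the search the sample point
  itself, so that the search starts with different values at its ends. For arbitrary
  \<open>f\<close> the run at least continues with a state longer by one.\<close>

lemma run_epoch_disagree:
  assumes "t \<in> set \<rho>" "f (fst t) \<noteq> f (keep c (fst ` set \<sigma>) (fst t))"
  obtains t' m where "t' \<in> set \<rho>"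
    "run f (epoch c r s \<sigma> \<rho> k) = run f (k ((m, keep c (fst ` set \<sigma> \<union> {..<Suc m}) (fst t')) # \<sigma>))"
    "keep c (fst ` set \<sigma> \<union> {..<2 ^ r}) (fst t') = fst t' \<Longrightarrow>
       f (keep c (fst ` set \<sigma> \<union> {..<Suc m}) (fst t')) \<noteq> f (keep c (fst ` set \<sigma> \<union> {..<m}) (fst t'))"
proof -
  define B where "B = fst ` set \<sigma>"
  define g where "g = (\<lambda>x. if x \<in> set (agreement_points c \<sigma> \<rho>) then f x else 0)"
  have g: "g (fst t) = f (fst t)" "g (keep c B (fst t)) = f (keep c B (fst t))"
    if "t \<in> set \<rho>" for t
    using that by (auto simp: g_def agreement_points_def B_def)
  have ask: "run f (ask_all (agreement_points c \<sigma> \<rho>) (\<lambda>_. 0) k') = run f (k' g)" for k'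
    by (simp only: run_ask_all g_def)
  have "g (fst t) \<noteq> g (keep c B (fst t))"
    using assms(2) g[OF assms(1)] by (simp add: B_def)
  then have "find (\<lambda>t. g (fst t) \<noteq> g (keep c B (fst t))) \<rho> \<noteq> None"
    unfolding find_None_iff using assms(1) by blast
  then obtain t' where t': "find (\<lambda>t. g (fst t) \<noteq> g (keep c B (fst t))) \<rho> = Some t'"
    by blast
  then have mem: "t' \<in> set \<rho>" and "g (fst t') \<noteq> g (keep c B (fst t'))"
    unfolding find_Some_iff by (blast intro: nth_mem)+
  then have neq: "f (fst t') \<noteq> f (keep c B (fst t'))"
    using g by simp
  have eq: "run f (epoch c r s \<sigma> \<rho> k) =
      run f (bsearch (\<lambda>m. keep c (B \<union> {..<m}) (fst t')) (f (keep c B (fst t'))) r 0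
              (\<lambda>m. k ((m, keep c (B \<union> {..<Suc m}) (fst t')) # \<sigma>)))"
    unfolding epoch_def Let_def ask B_def[symmetric] by (simp add: t' g[OF mem])
  obtain m where m: "run f (epoch c r s \<sigma> \<rho> k) = run f (k ((m, keep c (B \<union> {..<Suc m}) (fst t')) # \<sigma>))"
    "f (keep c (B \<union> {..<2 ^ r}) (fst t')) \<noteq> f (keep c B (fst t')) \<Longrightarrow>
      f (keep c (B \<union> {..<m}) (fst t')) = f (keep c B (fst t')) \<and>
      f (keep c (B \<union> {..<Suc m}) (fst t')) \<noteq> f (keep c B (fst t'))"
    using run_bsearch[of f "\<lambda>m. keep c (B \<union> {..<m}) (fst t')" "f (keep c B (fst t'))" r 0
        "\<lambda>m. k ((m, keep c (B \<union> {..<Suc m}) (fst t')) # \<sigma>)"]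
    unfolding eq by auto
  show ?thesis
    by (rule that[OF mem, folded B_def, OF m(1)]) (use m(2) neq in metis)
qed

section \<open>Counting queries\<close>

lemma keep_in_cube: "x \<in> cube n \<Longrightarrow> keep c B x \<in> cube n"
  by (auto simp: in_cube_iff keep_def)

lemma mix_in_cube: "v \<in> cube n \<Longrightarrow> mix c b v y \<in> cube n"
  by (auto simp: in_cube_iff mix_def)

lemma test_points_in_cube:
  assumes "snd ` set \<sigma> \<subseteq> cube n"
  shows "set (test_points c \<sigma> \<rho>) \<subseteq> cube n"
  using assms by (induction \<sigma>) (auto simp: test_points_def mix_in_cube simp del: zero_fun_apply)

lemma fst_trials_in_cube:
  assumes "\<rho> \<in> set_pmf (replicate_pmf N (trial n))" "t \<in> set \<rho>"
  shows "fst t \<in> cube n"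
proof -
  have "t \<in> set_pmf (trial n)"
    using assms unfolding set_replicate_pmf by auto
  then show ?thesis by auto
qed

lemma length_trials: "\<rho> \<in> set_pmf (replicate_pmf N p) \<Longrightarrow> length \<rho> = N"
  unfolding set_replicate_pmf by auto

lemma length_test_points: "length (test_points c \<sigma> \<rho>) = length \<sigma> * (5 * length \<rho> + 1)"
proof -
  have "length (concat (map trial_points \<rho>)) = 5 * length \<rho>"
    by (induction \<rho>) (auto simp: trial_points_def)
  then show ?thesis
    unfolding test_points_def by (induction \<sigma>) auto
qed

text \<open>After two queries per trial, an epoch either searches and continues, or makes the final
  tests and stops; \<open>r + q\<close> has to cover both branches.\<close>

lemma query_bound_epoch:
  assumes \<sigma>: "snd ` set \<sigma> \<subseteq> cube n" and \<rho>: "\<rho> \<in> set_pmf (replicate_pmf N (trial n))"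
    and k: "\<And>bv. snd bv \<in> cube n \<Longrightarrow> query_bound n q (k (bv # \<sigma>))"
    and q: "length \<sigma> * (5 * N + 1) \<le> r + q"
  shows "query_bound n (2 * N + r + q) (epoch c r s \<sigma> \<rho> k)"
proof -
  have len: "length \<rho> = N" by (rule length_trials[OF \<rho>])
  have fst: "fst t \<in> cube n" if "t \<in> set \<rho>" for t
    using fst_trials_in_cube[OF \<rho> that] .
  have "query_bound n (length (agreement_points c \<sigma> \<rho>) + (r + q)) (epoch c r s \<sigma> \<rho> k)"
    unfolding epoch_def Let_def
  proof (rule query_bound_ask_all)
    show "set (agreement_points c \<sigma> \<rho>) \<subseteq> cube n"
      using fst by (auto simp: agreement_points_def intro: keep_in_cube)
  next
    fix g
    show "query_bound n (r + q) (case find (\<lambda>t. g (fst t) \<noteq> g (keep c (fst ` set \<sigma>) (fst t))) \<rho> of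
        Some t \<Rightarrow> bsearch (\<lambda>m. keep c (fst ` set \<sigma> \<union> {..<m}) (fst t)) (g (keep c (fst ` set \<sigma>) (fst t))) r 0
              (\<lambda>m. k ((m, keep c (fst ` set \<sigma> \<union> {..<Suc m}) (fst t)) # \<sigma>))
      | None \<Rightarrow> ask_all (test_points c \<sigma> \<rho>) g (\<lambda>g. Output (accepts g c r s \<sigma> \<rho>)))"
    proof (cases "find (\<lambda>t. g (fst t) \<noteq> g (keep c (fst ` set \<sigma>) (fst t))) \<rho>")
      case None
      have "query_bound n (length (test_points c \<sigma> \<rho>) + 0)
          (ask_all (test_points c \<sigma> \<rho>) g (\<lambda>g. Output (accepts g c r s \<sigma> \<rho>)))"
        by (rule query_bound_ask_all)
          (auto simp: test_points_in_cube[OF \<sigma>] intro: query_bound.intros)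
      then have "query_bound n (r + q)
          (ask_all (test_points c \<sigma> \<rho>) g (\<lambda>g. Output (accepts g c r s \<sigma> \<rho>)))"
        by (rule query_bound_mono) (use q in \<open>simp add: length_test_points len\<close>)
      then show ?thesis using None by simp
    next
      case (Some t)
      then have "t \<in> set \<rho>"
        unfolding find_Some_iff by (blast intro: nth_mem)
      then have "fst t \<in> cube n" by (rule fst)
      then have "query_bound n (r + q)
         (bsearch (\<lambda>m. keep c (fst ` set \<sigma> \<union> {..<m}) (fst t)) (g (keep c (fst ` set \<sigma>) (fst t))) r 0
              (\<lambda>m. k ((m, keep c (fst ` set \<sigma> \<union> {..<Suc m}) (fst t)) # \<sigma>)))"
        by (intro query_bound_bsearch k) (auto intro: keep_in_cube)
      then show ?thesis using Some by simp
    qed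
  qed
  then show ?thesis
    by (simp add: agreement_points_def len mult_2 add.assoc)
qed

text \<open>The final tests happen at most once in a run, so \<open>K * (5 * N + 1)\<close> is added
  once; in every epoch they would cost a further factor of order \<open>K\<close>.\<close>

lemma query_bound_epochs:
  assumes "snd ` set \<sigma> \<subseteq> cube n" "length \<sigma> + e \<le> Suc K"
  shows "query_bound n (e * (2 * N + r) + K * (5 * N + 1)) (epochs n c r s N e \<sigma>)"
  using assms
proof (induction e arbitrary: \<sigma>)
  case (Suc e)
  have "query_bound n (2 * N + r + (e * (2 * N + r) + K * (5 * N + 1)))
      (epoch c r s \<sigma> \<rho> (epochs n c r s N e))" if "\<rho> \<in> set_pmf (replicate_pmf N (trial n))" for \<rho>
  proof (rule query_bound_epoch[OF Suc.prems(1) that])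
    have "length \<sigma> * (5 * N + 1) \<le> K * (5 * N + 1)"
      using Suc.prems(2) by (intro mult_right_mono) auto
    then show "length \<sigma> * (5 * N + 1) \<le> r + (e * (2 * N + r) + K * (5 * N + 1))"
      by simp
  qed (use Suc in auto)
  then show ?case
    by (auto intro!: query_bound.intros(3) simp: add.assoc)
qed (auto intro: query_bound.intros)

section \<open>Soundness\<close>

lemma card_bounded_subsets_le:
  assumes "finite A"
  shows "card {B. B \<subseteq> A \<and> card B \<le> m} \<le> (card A + 1) ^ m"
proof (induction m)
  case 0
  have "{B. B \<subseteq> A \<and> card B \<le> 0} \<subseteq> {{}}"
    using assms by (auto dest: finite_subset)
  then have "card {B. B \<subseteq> A \<and> card B \<le> 0} \<le> card {{} :: 'a set}"
    by (rule card_mono[rotated]) simp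
  then show ?case by simp
next
  case (Suc m)
  let ?S = "{B. B \<subseteq> A \<and> card B \<le> m}"
  have fin: "finite ?S" by (rule finite_subset[of _ "Pow A"]) (use assms in auto)
  have "{B. B \<subseteq> A \<and> card B \<le> Suc m} \<subseteq>
      ?S \<union> (\<lambda>(a, B). insert a B) ` (A \<times> ?S)"
  proof
    fix B assume B: "B \<in> {B. B \<subseteq> A \<and> card B \<le> Suc m}"
    show "B \<in> ?S \<union> (\<lambda>(a, B). insert a B) ` (A \<times> ?S)"
    proof (cases "card B \<le> m")
      case False
      then obtain a where a: "a \<in> B" using B by fastforce
      then have "B = insert a (B - {a})" "(a, B - {a}) \<in> A \<times> ?S"
        using B finite_subset[OF _ assms, of B] by (auto simp: card_Diff_singleton)
      then show ?thesis by (metis (no_types, lifting) UnI2 case_prod_conv image_eqI)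
    qed (use B in auto)
  qed
  then have "card {B. B \<subseteq> A \<and> card B \<le> Suc m} \<le>
      card (?S \<union> (\<lambda>(a, B). insert a B) ` (A \<times> ?S))"
    by (rule card_mono[rotated]) (use fin assms in auto)
  also have "\<dots> \<le> card ?S + card (A \<times> ?S)"
    using fin assms by (intro order_trans[OF card_Un_le] add_left_mono card_image_le) simp
  also have "\<dots> = (card A + 1) * card ?S"
    by (simp add: card_cartesian_product)
  also have "\<dots> \<le> (card A + 1) ^ Suc m"
    unfolding power_Suc by (rule mult_left_mono[OF Suc.IH]) simp
  finally show ?case .
qed

lemma finite_small_polys: "finite (small_polys k r s)"
proof (rule finite_subset)
  show "small_polys k r s \<subseteq> Pow (Pow {..<k})"
    by (auto simp: small_polys_def)
qed auto

lemma card_small_polys_le: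
  assumes "r \<ge> 1"
  shows "card (small_polys k r s) \<le> (k + 2) ^ (r * s)"
proof -
  let ?S = "{I. I \<subseteq> {..<k} \<and> card I \<le> r}"
  have "finite ?S" by (rule finite_subset[of _ "Pow {..<k}"]) auto
  then have "card (small_polys k r s) \<le> (card ?S + 1) ^ s"
    unfolding small_polys_def by (rule card_bounded_subsets_le)
  also have "\<dots> \<le> ((k + 1) ^ r + 1) ^ s"
    using card_bounded_subsets_le[of "{..<k}" r] by (intro power_mono) auto
  also have "\<dots> \<le> ((k + 2) ^ r) ^ s"
  \<comment> \<open>As \<open>r\<close> is positive, raising the base by 1 absorbs the summand
    1.\<close>
  proof (intro power_mono)
    have "(k + 1) ^ r < (k + 2) ^ r"
      using assms by (intro power_strict_mono) auto
    then show "(k + 1) ^ r + 1 \<le> (k + 2) ^ r" by simp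
  qed auto
  finally show ?thesis by (simp add: power_mult)
qed

text \<open>Distinct indices may yield equal terms, which cancel in pairs.\<close>

lemma sum_monotone_terms_collapse:
  assumes "finite A"
  obtains M where "M \<subseteq> \<phi> ` A" "card M \<le> card A"
    "\<And>x. (\<Sum>a\<in>A. monotone_term (\<phi> a) x) = (\<Sum>T\<in>M. monotone_term T x)"
proof -
  have "\<exists>M. M \<subseteq> \<phi> ` A \<and> card M \<le> card A \<and>
    (\<forall>x. (\<Sum>a\<in>A. monotone_term (\<phi> a) x) = (\<Sum>T\<in>M. monotone_term T x))"
    using assms
  proof induction
    case empty
    then show ?case by (intro exI[of _ "{}"]) simp
  next
    case (insert a A)
    then obtain M where M: "M \<subseteq> \<phi> ` A" "card M \<le> card A"
      "\<And>x. (\<Sum>a\<in>A. monotone_term (\<phi> a) x) = (\<Sum>T\<in>M. monotone_term T x)"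
      by blast
    have fin: "finite M" using M(1) insert by (meson finite_imageI finite_subset)
    show ?case
    proof (cases "\<phi> a \<in> M")
      case True
      have "(\<Sum>T\<in>M. monotone_term T x) = monotone_term (\<phi> a) x + (\<Sum>T\<in>M - {\<phi> a}. monotone_term T x)" for x
        using True fin by (rule sum.remove[rotated])
      then have "monotone_term (\<phi> a) x + (\<Sum>T\<in>M. monotone_term T x) =
          (\<Sum>T\<in>M - {\<phi> a}. monotone_term T x)" for x
        by (simp flip: add.assoc)
      then show ?thesis
        using insert M True fin by (intro exI[of _ "M - {\<phi> a}"]) (auto simp: card_Diff_singleton)
    next
      case False
      then show ?thesis
        using insert M fin by (intro exI[of _ "insert (\<phi> a) M"]) auto
    qed
  qed
  then show ?thesis using that by blast
qed

text \<open>Variables that coincide after the substitution merge, because bits are idempotent under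
  multiplication, and a single zero function kills the term.\<close>

lemma monotone_term_coord_or_zero:
  assumes "finite I"
  shows "monotone_term I (\<lambda>i. coord_or_zero (\<tau> i) x) =
    (if \<forall>i\<in>I. \<tau> i \<noteq> None then monotone_term ((\<lambda>i. the (\<tau> i)) ` I) x else 0)"
proof (cases "\<forall>i\<in>I. \<tau> i \<noteq> None")
  case True
  have idem: "(a :: bit) * (a * b) = a * b" for a b by (cases a) auto
  have "(\<Prod>i\<in>I. x (the (\<tau> i))) = (\<Prod>j\<in>(\<lambda>i. the (\<tau> i)) ` I. x j)"
    using assms
  proof induction
    case (insert i I)
    show ?case
    proof (cases "the (\<tau> i) \<in> (\<lambda>i. the (\<tau> i)) ` I")
      case True
      then have "(\<Prod>j\<in>(\<lambda>i. the (\<tau> i)) ` I. x j) =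
          x (the (\<tau> i)) * (\<Prod>j\<in>(\<lambda>i. the (\<tau> i)) ` I - {the (\<tau> i)}. x j)"
        using insert(1) by (intro prod.remove) auto
      then show ?thesis using insert True by (simp add: insert_absorb idem)
    qed (use insert in simp)
  qed simp
  moreover have "coord_or_zero (\<tau> i) x = x (the (\<tau> i))" if "i \<in> I" for i
    using True that by (auto simp: coord_or_zero_def)
  ultimately show ?thesis
    using True unfolding monotone_term_def by simp
next
  case False
  then obtain i where "i \<in> I" "\<tau> i = None" by blast
  then show ?thesis
    using False assms unfolding monotone_term_def
    by (auto simp: coord_or_zero_def intro!: prod_zero bexI[of _ i])
qed

text \<open>Substituting coordinates or zero into a candidate does not increase the number of terms.
  This is what makes \<open>eps_far\<close> applicable to the candidates.\<close>

lemma small_poly_of_coords_sparse: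
  assumes M: "M \<in> small_polys k r s" and \<tau>: "\<And>i. i < k \<Longrightarrow> set_option (\<tau> i) \<subseteq> {..<n}"
  shows "(\<lambda>x. \<Sum>I\<in>M. monotone_term I (\<lambda>i. coord_or_zero (\<tau> i) x)) \<in> sparse_polynomial n s"
proof -
  define A where "A = {I \<in> M. \<forall>i\<in>I. \<tau> i \<noteq> None}"
  have sub: "I \<subseteq> {..<k}" if "I \<in> M" for I
    using M that by (auto simp: small_polys_def)
  have finM: "finite M"
    using sub by (intro finite_subset[of M "Pow {..<k}"]) auto
  have finA: "finite A" using finM by (simp add: A_def)
  have cardA: "card A \<le> s"
    using card_mono[OF finM, of A] M by (auto simp: A_def small_polys_def)
  obtain M' where M': "M' \<subseteq> (`) (\<lambda>i. the (\<tau> i)) ` A" "card M' \<le> card A"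
    "\<And>x. (\<Sum>I\<in>A. monotone_term ((\<lambda>i. the (\<tau> i)) ` I) x) = (\<Sum>T\<in>M'. monotone_term T x)"
    by (rule sum_monotone_terms_collapse[OF finA, where \<phi> = "(`) (\<lambda>i. the (\<tau> i))"]) blast
  have "(\<Sum>I\<in>M. monotone_term I (\<lambda>i. coord_or_zero (\<tau> i) x)) = (\<Sum>T\<in>M'. monotone_term T x)" for x
  proof -
    have "(\<Sum>I\<in>M. monotone_term I (\<lambda>i. coord_or_zero (\<tau> i) x)) =
      (\<Sum>I\<in>M. if \<forall>i\<in>I. \<tau> i \<noteq> None then monotone_term ((\<lambda>i. the (\<tau> i)) ` I) x else 0)"
      by (intro sum.cong refl monotone_term_coord_or_zero) (meson sub finite_lessThan finite_subset)
    also have "\<dots> = (\<Sum>I\<in>A. monotone_term ((\<lambda>i. the (\<tau> i)) ` I) x)"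
      unfolding A_def using finM by (rule sum.inter_filter[symmetric])
    finally show ?thesis using M'(3) by simp
  qed
  moreover have "M' \<subseteq> Pow {..<n}"
  proof
    fix T assume "T \<in> M'"
    then obtain I where I: "I \<in> M" "\<forall>i\<in>I. \<tau> i \<noteq> None" "T = (\<lambda>i. the (\<tau> i)) ` I"
      using M'(1) by (auto simp: A_def)
    have "the (\<tau> i) < n" if "i \<in> I" for i
      using \<tau>[of i] sub[OF I(1)] I(2) that by (cases "\<tau> i") auto
    then show "T \<in> Pow {..<n}" using I(3) by auto
  qed
  ultimately show ?thesis
    using M'(2) cardA unfolding sparse_polynomial_def by (auto intro!: exI[of _ M'])
qed

section \<open>Rejection of far functions\<close>

text \<open>For a fixed state there are two cases. If some response fails the coordinate test with
  probability above \<open>\<epsilon> / (4 * K)\<close>, all \<open>N\<close> trials have to miss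
  this. Otherwise each response is within \<open>\<epsilon> / (2 * K)\<close> of a coordinate or
  zero, so every candidate is within \<open>\<epsilon> / 2\<close> of a sparse polynomial and
  differs from \<open>f\<close> with probability at least \<open>\<epsilon> / 2\<close>; a union
  bound over the candidates follows.\<close>

lemma prob_accepts_le:
  assumes far: "eps_far n \<epsilon> (sparse_polynomial n s) f" and \<epsilon>: "0 \<le> \<epsilon>" "\<epsilon> \<le> 1"
    and len: "length \<sigma> \<le> K" and K: "K \<ge> 8" and r: "r \<ge> 1"
  shows "measure_pmf.prob (replicate_pmf N (trial n)) {\<rho>. accepts f c r s \<sigma> \<rho>} \<le>
    real K * (1 - \<epsilon> / (4 * K)) ^ N + real ((K + 2) ^ (r * s)) * (1 - \<epsilon> / 2) ^ N"
proof -
  let ?R = "replicate_pmf N (trial n)" and ?d = "\<epsilon> / (4 * K)"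
  define h where "h i = response f c (\<sigma> ! i)" for i
  define k where "k = length \<sigma>"
  \<comment> \<open>\<open>K \<ge> 8\<close> brings \<open>?d\<close> down to 1/32, below the 1/28
    required by \<open>coord_test_sound\<close>.\<close>
  have d0: "0 \<le> ?d" "?d \<le> 1/32" "0 \<le> 1 - ?d"
    using \<epsilon> K by (auto simp: field_simps)
  show ?thesis
  proof (cases "\<exists>i<k. measure_pmf.prob (trial n) {t. \<not> coord_test (h i) t} > ?d")
    case True
    then obtain i where i: "i < k" "measure_pmf.prob (trial n) {t. \<not> coord_test (h i) t} > ?d"
      by blast
    have "measure_pmf.prob ?R {\<rho>. accepts f c r s \<sigma> \<rho>} \<le>
        measure_pmf.prob ?R {\<rho>. \<forall>t\<in>set \<rho>. t \<in> {t. coord_test (h i) t}}"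
      by (rule prob_mono) (use i in \<open>auto simp: accepts_def h_def k_def\<close>)
    also have "\<dots> = measure_pmf.prob (trial n) {t. coord_test (h i) t} ^ N"
      by (rule prob_replicate_all)
    also have "\<dots> \<le> (1 - ?d) ^ N"
      using i(2) prob_compl'[of "trial n" "coord_test (h i)"] by (intro power_mono) auto
    also have "\<dots> \<le> real K * (1 - ?d) ^ N"
      using mult_right_mono[of 1 "real K" "(1 - ?d) ^ N"] K d0 by simp
    also have "\<dots> \<le> real K * (1 - ?d) ^ N + real ((K + 2) ^ (r * s)) * (1 - \<epsilon> / 2) ^ N"
      using \<epsilon> by auto
    finally show ?thesis .
  next
    case False
    have "\<forall>i\<in>{..<k}. \<exists>c. set_option c \<subseteq> {..<n} \<and> measure_pmf.prob (unif n) {x. h i x \<noteq> coord_or_zero c x} \<le> 2 * ?d"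
    proof
      fix i assume "i \<in> {..<k}"
      then have "measure_pmf.prob (trial n) {t. \<not> coord_test (h i) t} \<le> ?d"
        using False not_less by blast
      moreover have "28 * ?d < 1" using d0 by linarith
      ultimately show "\<exists>c. set_option c \<subseteq> {..<n} \<and> measure_pmf.prob (unif n) {x. h i x \<noteq> coord_or_zero c x} \<le> 2 * ?d"
        by (rule coord_test_sound) blast
    qed
    from bchoice[OF this] obtain \<tau> where \<tau>: "\<And>i. i < k \<Longrightarrow> set_option (\<tau> i) \<subseteq> {..<n}"
      "\<And>i. i < k \<Longrightarrow> measure_pmf.prob (unif n) {x. h i x \<noteq> coord_or_zero (\<tau> i) x} \<le> 2 * ?d"
      by blast
    define G where "G M x = (\<Sum>I\<in>M. monotone_term I (\<lambda>i. h i x))" for M x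
    have close: "measure_pmf.prob (unif n) (\<Union>i\<in>{..<k}. {x. h i x \<noteq> coord_or_zero (\<tau> i) x}) \<le> \<epsilon> / 2"
    proof -
      have "measure_pmf.prob (unif n) (\<Union>i\<in>{..<k}. {x. h i x \<noteq> coord_or_zero (\<tau> i) x}) \<le>
          real (card {..<k}) * (2 * ?d)"
        by (rule prob_UN_le) (use \<tau> in auto)
      also have "\<dots> \<le> real K * (2 * ?d)"
        using len d0 by (intro mult_right_mono) (auto simp: k_def)
      also have "\<dots> = \<epsilon> / 2" using K by simp
      finally show ?thesis .
    qed
    have pass: "measure_pmf.prob (unif n) {x. f x = G M x} \<le> 1 - \<epsilon> / 2" if M: "M \<in> small_polys k r s" for M
    proof -
      have "\<epsilon> \<le> measure_pmf.prob (unif n) {x. f x \<noteq> (\<Sum>I\<in>M. monotone_term I (\<lambda>i. coord_or_zero (\<tau> i) x))}"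
        using far small_poly_of_coords_sparse[OF M \<tau>(1)] by (auto simp: eps_far_def)
      also have "\<dots> \<le> measure_pmf.prob (unif n)
          ({x. \<not> f x = G M x} \<union> (\<Union>i\<in>{..<k}. {x. h i x \<noteq> coord_or_zero (\<tau> i) x}))"
      proof (rule prob_mono)
        fix x assume x: "x \<in> {x. f x \<noteq> (\<Sum>I\<in>M. monotone_term I (\<lambda>i. coord_or_zero (\<tau> i) x))}"
        show "x \<in> {x. \<not> f x = G M x} \<union> (\<Union>i\<in>{..<k}. {x. h i x \<noteq> coord_or_zero (\<tau> i) x})"
        proof (rule ccontr)
          assume no: "x \<notin> {x. \<not> f x = G M x} \<union> (\<Union>i\<in>{..<k}. {x. h i x \<noteq> coord_or_zero (\<tau> i) x})"
          then have "G M x = (\<Sum>I\<in>M. monotone_term I (\<lambda>i. coord_or_zero (\<tau> i) x))"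
            unfolding G_def monotone_term_def using M
            by (intro sum.cong prod.cong refl) (auto simp: small_polys_def)
          then show False using x no by auto
        qed
      qed
      also have "\<dots> \<le> (1 - measure_pmf.prob (unif n) {x. f x = G M x}) + \<epsilon> / 2"
        using close prob_compl'[of "unif n" "\<lambda>x. f x = G M x"]
        by (intro order_trans[OF prob_Un_le] add_mono) auto
      finally show ?thesis by linarith
    qed
    have "measure_pmf.prob ?R {\<rho>. accepts f c r s \<sigma> \<rho>} \<le>
        measure_pmf.prob ?R (\<Union>M\<in>small_polys k r s. {\<rho>. \<forall>t\<in>set \<rho>. t \<in> {t. f (fst t) = G M (fst t)}})"
      by (rule prob_mono) (auto simp: accepts_def G_def h_def k_def)
    also have "\<dots> \<le> real (card (small_polys k r s)) * (1 - \<epsilon> / 2) ^ N"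
    proof (rule prob_UN_le[OF finite_small_polys])
      fix M assume "M \<in> small_polys k r s"
      then show "measure_pmf.prob ?R {\<rho>. \<forall>t\<in>set \<rho>. t \<in> {t. f (fst t) = G M (fst t)}} \<le> (1 - \<epsilon> / 2) ^ N"
        unfolding prob_replicate_all using pass prob_pair_fst[of "unif n" "pair_pmf (unif n) (unif n)" "{x. f x = G M x}"]
        by (intro power_mono) auto
    qed
    also have "\<dots> \<le> real ((K + 2) ^ (r * s)) * (1 - \<epsilon> / 2) ^ N"
    proof (intro mult_right_mono of_nat_mono)
      have "card (small_polys k r s) \<le> (k + 2) ^ (r * s)"
        by (rule card_small_polys_le[OF r])
      also have "\<dots> \<le> (K + 2) ^ (r * s)"
        using len by (intro power_mono) (auto simp: k_def)
      finally show "card (small_polys k r s) \<le> (K + 2) ^ (r * s)" .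
    qed (use \<epsilon> in auto)
    also have "\<dots> \<le> real K * (1 - ?d) ^ N + real ((K + 2) ^ (r * s)) * (1 - \<epsilon> / 2) ^ N"
      using d0 by auto
    finally show ?thesis .
  qed
qed

text \<open>Union bound over the epochs. The state is fixed before the trials of its epoch are
  drawn, and the bound \<open>b\<close> holds for every state the run can reach, including those
  with useless witnesses.\<close>

lemma prob_epochs_True_le:
  assumes "\<And>\<sigma>. length \<sigma> \<le> K \<Longrightarrow>
      measure_pmf.prob (replicate_pmf N (trial n)) {\<rho>. accepts f c r s \<sigma> \<rho>} \<le> b"
    and "0 \<le> b" and "length \<sigma> + e \<le> Suc K"
  shows "measure_pmf.prob (run f (epochs n c r s N e \<sigma>)) {True} \<le> real e * b"
  using assms(3)
proof (induction e arbitrary: \<sigma>)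
  case (Suc e)
  have "measure_pmf.prob (run f (epochs n c r s N (Suc e) \<sigma>)) {True} \<le>
      measure_pmf.prob (replicate_pmf N (trial n)) {\<rho>. accepts f c r s \<sigma> \<rho>} + real e * b"
    unfolding epochs.simps run_Sample_map
  proof (rule prob_bind_le)
    fix \<rho> assume \<rho>: "\<rho> \<notin> {\<rho>. accepts f c r s \<sigma> \<rho>}"
    let ?A = "run f (epoch c r s \<sigma> \<rho> (epochs n c r s N e))"
    show "measure_pmf.prob ?A {True} \<le> real e * b"
    proof (cases "\<forall>t\<in>set \<rho>. f (fst t) = f (keep c (fst ` set \<sigma>) (fst t))")
      case True
      then have "?A = return_pmf False"
        using \<rho> by (subst run_epoch_agree) auto
      then show ?thesis using assms(2) by simp
    next
      case False
      then obtain t where "t \<in> set \<rho>" "f (fst t) \<noteq> f (keep c (fst ` set \<sigma>) (fst t))"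
        by blast
      then obtain bv where "?A = run f (epochs n c r s N e (bv # \<sigma>))"
        by (rule run_epoch_disagree[where r = r and s = s and k = "epochs n c r s N e"]) blast
      then show ?thesis using Suc.IH[of "bv # \<sigma>"] Suc.prems by simp
    qed
  qed (use assms(2) in auto)
  also have "\<dots> \<le> b + real e * b"
    using assms(1)[of \<sigma>] Suc.prems by simp
  finally show ?case by (simp add: algebra_simps)
qed simp

section \<open>Completeness\<close>

lemma bit_mult_eq_1_iff: "(a :: bit) * b = 1 \<longleftrightarrow> a = 1 \<and> b = 1"
  by (cases a; cases b) simp_all

lemma mix_le: "mix c b v y i = 1 \<Longrightarrow> v i = 1"
  by (cases "v i") (auto simp: mix_def split: if_splits)

lemma keep_le: "keep c B x i = 1 \<Longrightarrow> x i = 1"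
  by (auto simp: keep_def split: if_splits)

lemma monotone_term_eq_1_iff:
  "finite T \<Longrightarrow> monotone_term T x = 1 \<longleftrightarrow> (\<forall>i\<in>T. x i = 1)"
  unfolding monotone_term_def by (induction T rule: finite_induct) (auto simp: bit_mult_eq_1_iff)

lemma prob_all_ones:
  assumes "T \<subseteq> {..<n}"
  shows "measure_pmf.prob (unif n) {x. \<forall>i\<in>T. x i = 1} = (1/2) ^ card T"
proof -
  let ?B = "\<lambda>i. if i \<in> T then {1} else UNIV :: bit set"
  have UNIV_bit: "(UNIV :: bit set) = {0, 1}"
    by (auto intro: bit.exhaust)
  have "unif n = Pi_pmf {..<n} 0 (\<lambda>_. pmf_of_set (UNIV :: bit set))"
    unfolding cube_def by (rule Pi_pmf_of_set[symmetric]) auto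
  moreover have "{x :: nat \<Rightarrow> bit. \<forall>i\<in>T. x i = 1} = Pi {..<n} ?B"
    using assms by (auto simp: Pi_def)
  ultimately have "measure_pmf.prob (unif n) {x. \<forall>i\<in>T. x i = 1} =
      measure_pmf.prob (Pi_pmf {..<n} 0 (\<lambda>_. pmf_of_set (UNIV :: bit set))) (Pi {..<n} ?B)"
    by simp
  also have "\<dots> =
      (\<Prod>i\<in>{..<n}. measure_pmf.prob (pmf_of_set UNIV) (?B i))"
    by (rule measure_Pi_pmf_Pi) simp
  also have "\<dots> = (\<Prod>i\<in>{..<n}. if i \<in> T then 1/2 else 1)"
    by (intro prod.cong refl) (simp add: measure_pmf_of_set UNIV_bit)
  also have "\<dots> = (\<Prod>i\<in>T. 1/2)"
    using assms by (subst prod.inter_restrict[symmetric]) (auto simp: Int_absorb1)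
  finally show ?thesis by simp
qed

section \<open>Separating variables by a random hash\<close>

definition hash :: "nat \<Rightarrow> nat \<Rightarrow> (nat \<Rightarrow> nat) pmf" where
  "hash n m = Pi_pmf {..<n} 0 (\<lambda>_. pmf_of_set {..<m})"

lemma hash_range:
  assumes "c \<in> set_pmf (hash n m)" "m > 0" "i < n"
  shows "c i < m"
  using assms unfolding hash_def by (auto simp: set_Pi_pmf PiE_dflt_def set_pmf_of_set lessThan_empty_iff)

lemma prob_hash_collision:
  assumes "i < n" "j < n" "i \<noteq> j" "m > 0"
  shows "measure_pmf.prob (hash n m) {c. c i = c j} = 1 / real m"
proof -
  have "measure_pmf.prob (hash n m) {c. c i = c j} =
      (\<Sum>b<m. measure_pmf.prob (hash n m) {c. c i = b \<and> c j = b})"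
  proof -
    have "measure_pmf.prob (hash n m) {c. c i = c j} =
        measure_pmf.prob (hash n m) (\<Union>b\<in>{..<m}. {c. c i = b \<and> c j = b})"
      by (rule prob_cong) (use hash_range assms in auto)
    also have "\<dots> = (\<Sum>b<m. measure_pmf.prob (hash n m) {c. c i = b \<and> c j = b})"
      by (rule measure_pmf.finite_measure_finite_Union) (auto simp: disjoint_family_on_def)
    finally show ?thesis .
  qed
  also have "\<dots> = (\<Sum>b<m. 1 / real m * (1 / real m))"
  proof (rule sum.cong[OF refl])
    fix b assume b: "b \<in> {..<m}"
    let ?B = "\<lambda>k. if k = i \<or> k = j then {b} else UNIV"
    have "{c :: nat \<Rightarrow> nat. c i = b \<and> c j = b} = Pi {..<n} ?B"
      using assms by (auto simp: Pi_def)
    then have "measure_pmf.prob (hash n m) {c. c i = b \<and> c j = b} =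
        (\<Prod>k\<in>{..<n}. measure_pmf.prob (pmf_of_set {..<m}) (?B k))"
      unfolding hash_def by (simp add: measure_Pi_pmf_Pi)
    also have "\<dots> = (\<Prod>k\<in>{..<n}. if k \<in> {i, j} then 1 / real m else 1)"
      using b assms by (intro prod.cong refl) (auto simp: measure_pmf_of_set lessThan_empty_iff)
    also have "\<dots> = (\<Prod>k\<in>{i, j}. 1 / real m)"
      using assms by (subst prod.inter_restrict[symmetric]) (auto simp: Int_absorb1)
    finally show "measure_pmf.prob (hash n m) {c. c i = b \<and> c j = b} = 1 / real m * (1 / real m)"
      using assms by simp
  qed
  also have "\<dots> = 1 / real m" using assms by simp
  finally show ?thesis .
qed

text \<open>Birthday bound, taken over the ordered pairs of distinct elements of
  \<open>R\<close>.\<close>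

lemma prob_hash_not_inj_le:
  assumes R: "R \<subseteq> {..<n}" and m: "m > 0"
  shows "measure_pmf.prob (hash n m) {c. \<not> inj_on c R} \<le> real (card R ^ 2) * (1 / real m)"
proof -
  have fin: "finite R" using R finite_subset by blast
  let ?D = "{(i, j). i \<in> R \<and> j \<in> R \<and> i \<noteq> j}"
  have D: "?D \<subseteq> R \<times> R" by auto
  have "measure_pmf.prob (hash n m) {c. \<not> inj_on c R} =
      measure_pmf.prob (hash n m) (\<Union>z\<in>?D. {c. c (fst z) = c (snd z)})"
    by (rule arg_cong[where f = "measure_pmf.prob (hash n m)"]) (auto simp: inj_on_def, blast)
  also have "\<dots> \<le> real (card ?D) * (1 / real m)"
    by (rule prob_UN_le) (use R m fin in \<open>auto simp: prob_hash_collision subset_iff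
        intro: finite_subset[OF D]\<close>)
  also have "\<dots> \<le> real (card R ^ 2) * (1 / real m)"
    using card_mono[OF _ D] fin
    by (intro mult_right_mono of_nat_mono) (auto simp: card_cartesian_product power2_eq_square)
  finally show ?thesis .
qed

section \<open>A sparse polynomial away from its long terms\<close>

locale sparse_target =
  fixes n s r :: nat and f :: boolfun and M :: "nat set set"
  assumes M_sub: "M \<subseteq> Pow {..<n}" and card_M: "card M \<le> s"
    and f_eq: "x \<in> cube n \<Longrightarrow> f x = (\<Sum>T\<in>M. monotone_term T x)"
begin

definition low :: "nat set set" where
  "low = {T \<in> M. card T \<le> r}"

definition relevant :: "nat set" where
  "relevant = \<Union>low"

text \<open>Heaviness is upward closed, so all points below a light point are light. On light points
  \<open>f\<close> coincides with the polynomial made of the terms in \<open>low\<close>.\<close>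

definition heavy :: "(nat \<Rightarrow> bit) \<Rightarrow> bool" where
  "heavy x \<longleftrightarrow> (\<exists>T\<in>M. card T > r \<and> (\<forall>i\<in>T. x i = 1))"

lemma finite_M: "finite M"
  using M_sub by (rule finite_subset) simp

lemma finite_term: "T \<in> M \<Longrightarrow> finite T"
  using M_sub finite_subset by blast

lemma finite_low: "finite low"
  using finite_M by (simp add: low_def)

lemma relevant_sub: "relevant \<subseteq> {..<n}"
  using M_sub by (auto simp: relevant_def low_def)

lemma finite_relevant: "finite relevant"
  using relevant_sub finite_subset by blast

lemma card_relevant: "card relevant \<le> s * r"
proof -
  have "card relevant \<le> (\<Sum>T\<in>low. card T)"
    unfolding relevant_def by (rule card_Union_le_sum_card)
  also have "\<dots> \<le> card low * r"
    using sum_bounded_above[of low card r] by (simp add: low_def)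
  also have "\<dots> \<le> s * r"
    using card_M card_mono[OF finite_M, of low] by (intro mult_right_mono) (auto simp: low_def)
  finally show ?thesis .
qed

lemma heavy_mono: "heavy x \<Longrightarrow> (\<And>i. x i = 1 \<Longrightarrow> y i = 1) \<Longrightarrow> heavy y"
  unfolding heavy_def by blast

lemma prob_heavy_le: "measure_pmf.prob (unif n) {x. heavy x} \<le> real s * (1/2) ^ r"
proof -
  have "heavy x \<longleftrightarrow> (\<exists>T\<in>M - low. \<forall>i\<in>T. x i = 1)" for x
    unfolding heavy_def low_def not_le[symmetric] by blast
  then have "measure_pmf.prob (unif n) {x. heavy x} =
      measure_pmf.prob (unif n) (\<Union>T\<in>M - low. {x. \<forall>i\<in>T. x i = 1})"
    by (intro arg_cong[where f = "measure_pmf.prob (unif n)"]) auto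
  also have "\<dots> \<le> real (card (M - low)) * (1/2) ^ r"
  proof (rule prob_UN_le)
    fix T assume T: "T \<in> M - low"
    then have "measure_pmf.prob (unif n) {x. \<forall>i\<in>T. x i = 1} = (1/2) ^ card T"
      using M_sub by (intro prob_all_ones) auto
    also have "\<dots> \<le> (1/2) ^ r"
      using T by (intro power_decreasing) (auto simp: low_def)
    finally show "measure_pmf.prob (unif n) {x. \<forall>i\<in>T. x i = 1} \<le> (1/2) ^ r" .
  qed (use finite_M in auto)
  also have "\<dots> \<le> real s * (1/2) ^ r"
    using card_M card_mono[OF finite_M, of "M - low"] by (intro mult_right_mono of_nat_mono) auto
  finally show ?thesis .
qed

lemma f_light:
  assumes "x \<in> cube n" "\<not> heavy x"
  shows "f x = (\<Sum>T\<in>low. monotone_term T x)"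
proof -
  have "(\<Sum>T\<in>M. monotone_term T x) = (\<Sum>T\<in>low. monotone_term T x)"
  proof (rule sum.mono_neutral_right)
    show "\<forall>T\<in>M - low. monotone_term T x = 0"
    proof
      fix T assume T: "T \<in> M - low"
      then have "\<not> (\<forall>i\<in>T. x i = 1)"
        using assms(2) by (auto simp: heavy_def low_def)
      then show "monotone_term T x = 0"
        using monotone_term_eq_1_iff[OF finite_term, of T x] T by (metis DiffD1 bit_not_zero_iff)
    qed
  qed (use finite_M in \<open>auto simp: low_def\<close>)
  then show ?thesis using f_eq[OF assms(1)] by simp
qed

lemma f_light_cong:
  assumes "x \<in> cube n" "\<not> heavy x" "y \<in> cube n" "\<not> heavy y" "\<And>i. i \<in> relevant \<Longrightarrow> x i = y i"
  shows "f x = f y"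
  unfolding f_light[OF assms(1,2)] f_light[OF assms(3,4)] monotone_term_def
  using assms(5) by (intro sum.cong prod.cong) (auto simp: relevant_def)

definition witness :: "(nat \<Rightarrow> nat) \<Rightarrow> nat \<times> (nat \<Rightarrow> bit) \<Rightarrow> bool" where
  "witness c = (\<lambda>(b, v). v \<in> cube n \<and> \<not> heavy v \<and> f v \<noteq> f (mix c b v 0))"

text \<open>Zeroing block \<open>b\<close> changes \<open>f\<close> at a light point, hence changes
  some relevant variable \<open>i\<close> of that block; as \<open>c\<close> is injective, it is the
  only relevant one there. Since \<open>v i = 1\<close>, the point \<open>mix c b v y\<close> looks
  to \<open>f\<close> like \<open>v\<close> or like the zeroed \<open>v\<close>, according to
  \<open>y i\<close>.\<close>

lemma response_witness:
  assumes inj: "inj_on c relevant" and w: "witness c (b, v)"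
  obtains i where "i \<in> relevant" "c i = b" "\<And>y. response f c (b, v) y = y i"
proof -
  have v: "v \<in> cube n" "\<not> heavy v" "f v \<noteq> f (mix c b v 0)"
    using w by (auto simp: witness_def)
  have light: "\<not> heavy (mix c b v y)" for y
    using v(2) heavy_mono mix_le by blast
  have cube: "mix c b v y \<in> cube n" for y
    using v(1) by (rule mix_in_cube)
  obtain i where i: "i \<in> relevant" "v i \<noteq> mix c b v 0 i"
    using v f_light_cong[OF v(1,2) cube light] by blast
  then have ci: "c i = b" "v i = 1"
    by (auto simp: mix_def split: if_splits)
  have eq: "j = i" if "j \<in> relevant" "c j = b" for j
    using inj_onD[OF inj, of j i] that i ci by auto
  have "response f c (b, v) y = y i" for y
  proof (cases "y i = 0")
    case True
    have "f (mix c b v y) = f (mix c b v 0)"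
      by (rule f_light_cong) (use cube light eq True in \<open>auto simp: mix_def\<close>)
    then show ?thesis using True by (simp add: response_def)
  next
    case False
    have "f (mix c b v y) = f v"
      by (rule f_light_cong) (use cube light eq False v in \<open>auto simp: mix_def\<close>)
    moreover have "f v + f (mix c b v 0) = 1"
      using v(3) by (cases "f v"; cases "f (mix c b v 0)") auto
    ultimately show ?thesis using False by (simp add: response_def)
  qed
  then show ?thesis using that i ci by blast
qed

section \<open>Valid states and acceptance of sparse polynomials\<close>

definition valid :: "(nat \<Rightarrow> nat) \<Rightarrow> state \<Rightarrow> bool" where
  "valid c \<sigma> \<longleftrightarrow> distinct (map fst \<sigma>) \<and> (\<forall>bv\<in>set \<sigma>. witness c bv)"

lemma valid_coords:
  assumes inj: "inj_on c relevant" and val: "valid c \<sigma>"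
  obtains \<tau> where "\<And>i. i < length \<sigma> \<Longrightarrow> \<tau> i \<in> relevant" "\<And>i. i < length \<sigma> \<Longrightarrow> c (\<tau> i) = fst (\<sigma> ! i)"
    "\<And>i y. i < length \<sigma> \<Longrightarrow> response f c (\<sigma> ! i) y = y (\<tau> i)" "inj_on \<tau> {..<length \<sigma>}"
proof -
  have "\<forall>i\<in>{..<length \<sigma>}. \<exists>j. j \<in> relevant \<and> c j = fst (\<sigma> ! i) \<and> (\<forall>y. response f c (\<sigma> ! i) y = y j)"
  proof
    fix i assume "i \<in> {..<length \<sigma>}"
    then have "witness c (fst (\<sigma> ! i), snd (\<sigma> ! i))"
      using val by (simp add: valid_def)
    then show "\<exists>j. j \<in> relevant \<and> c j = fst (\<sigma> ! i) \<and> (\<forall>y. response f c (\<sigma> ! i) y = y j)"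
      by (rule response_witness[OF inj]) auto
  qed
  from bchoice[OF this] obtain \<tau> where \<tau>: "\<And>i. i < length \<sigma> \<Longrightarrow> \<tau> i \<in> relevant"
    "\<And>i. i < length \<sigma> \<Longrightarrow> c (\<tau> i) = fst (\<sigma> ! i)"
    "\<And>i y. i < length \<sigma> \<Longrightarrow> response f c (\<sigma> ! i) y = y (\<tau> i)"
    by blast
  have "inj_on \<tau> {..<length \<sigma>}"
  proof (rule inj_onI)
    fix i j assume ij: "i \<in> {..<length \<sigma>}" "j \<in> {..<length \<sigma>}" "\<tau> i = \<tau> j"
    then have "map fst \<sigma> ! i = map fst \<sigma> ! j"
      using \<tau>(2)[of i] \<tau>(2)[of j] by simp
    then show "i = j"
      using val ij by (simp add: valid_def nth_eq_iff_index_eq del: nth_map)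
  qed
  with \<tau> show ?thesis by (rule that)
qed

text \<open>Each block of the state contains a relevant variable of its own.\<close>

lemma length_valid_le:
  assumes "inj_on c relevant" "valid c \<sigma>"
  shows "length \<sigma> \<le> s * r"
proof -
  obtain \<tau> where "\<And>i. i < length \<sigma> \<Longrightarrow> \<tau> i \<in> relevant" "inj_on \<tau> {..<length \<sigma>}"
    by (rule valid_coords[OF assms]) blast
  then have "card {..<length \<sigma>} \<le> card relevant"
    by (intro card_inj_on_le[of \<tau>]) (use finite_relevant in auto)
  then show ?thesis using card_relevant by simp
qed

text \<open>The responses are exact coordinates, so no coordinate test fails. The accepted candidate
  consists of the short terms all of whose variables were found, pulled back along
  \<open>\<tau>\<close>. The other short terms vanish once the unknown blocks are zeroed, and by
  \<open>agree\<close> this zeroing does not change \<open>f\<close> on the sample.\<close>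

lemma accepts_valid:
  assumes inj: "inj_on c relevant" and val: "valid c \<sigma>"
    and \<rho>: "\<And>t. t \<in> set \<rho> \<Longrightarrow> fst t \<in> cube n" "\<And>t. t \<in> set \<rho> \<Longrightarrow> \<not> heavy (fst t)"
    and agree: "\<And>t. t \<in> set \<rho> \<Longrightarrow> f (fst t) = f (keep c (fst ` set \<sigma>) (fst t))"
  shows "accepts f c r s \<sigma> \<rho>"
proof -
  define k where "k = length \<sigma>"
  obtain \<tau> where \<tau>: "\<And>i. i < k \<Longrightarrow> \<tau> i \<in> relevant" "\<And>i. i < k \<Longrightarrow> c (\<tau> i) = fst (\<sigma> ! i)"
    "\<And>i y. i < k \<Longrightarrow> response f c (\<sigma> ! i) y = y (\<tau> i)" "inj_on \<tau> {..<k}"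
    unfolding k_def by (rule valid_coords[OF inj val]) blast
  have test: "coord_test (response f c bv) t" if bv: "bv \<in> set \<sigma>" for bv t
  proof -
    obtain i where "i < k" "bv = \<sigma> ! i"
      using bv by (auto simp: in_set_conv_nth k_def)
    then show ?thesis using \<tau>(3) by (simp add: coord_test_def split: prod.split)
  qed
  define I where "I T = {i. i < k \<and> \<tau> i \<in> T}" for T
  define L where "L = {T \<in> low. T \<subseteq> \<tau> ` {..<k}}"
  have img: "\<tau> ` I T = T" if "T \<in> L" for T
    using that by (auto simp: I_def L_def)
  have injI: "inj_on I L"
    by (rule inj_on_inverseI[of _ "\<lambda>J. \<tau> ` J"]) (rule img)
  have inj\<tau>: "inj_on \<tau> (I T)" for T
    using \<tau>(4) by (rule inj_on_subset) (auto simp: I_def)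
  have finL: "finite L" using finite_low by (simp add: L_def)
  have "I ` L \<in> small_polys k r s"
  proof -
    have "card (I T) \<le> r" if "T \<in> L" for T
      using card_image[OF inj\<tau>, of T] img[OF that] that by (auto simp: L_def low_def)
    moreover have "card (I ` L) \<le> card M"
      using card_image_le[OF finL, of I] card_mono[OF finite_M, of L] by (force simp: L_def low_def)
    ultimately show ?thesis
      using card_M by (auto simp: small_polys_def I_def)
  qed
  moreover have "f (fst t) = (\<Sum>J\<in>I ` L. monotone_term J (\<lambda>i. response f c (\<sigma> ! i) (fst t)))"
    if t: "t \<in> set \<rho>" for t
  proof -
    define x where "x = fst t"
    let ?z = "keep c (fst ` set \<sigma>) x"
    have z: "?z \<in> cube n" "\<not> heavy ?z"
      using \<rho>[OF t] heavy_mono keep_le by (auto simp: x_def intro: keep_in_cube)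
    \<comment> \<open>Injectivity of \<open>c\<close> excludes a second relevant variable in a known
      block.\<close>
    have kept: "c j \<in> fst ` set \<sigma> \<longleftrightarrow> j \<in> \<tau> ` {..<k}" if j: "j \<in> relevant" for j
    proof
      assume "c j \<in> fst ` set \<sigma>"
      then obtain i where i: "i < k" "c j = fst (\<sigma> ! i)"
        by (auto simp: k_def in_set_conv_nth)
      then have "j = \<tau> i"
        using inj_onD[OF inj, of j "\<tau> i"] \<tau>(1,2)[OF i(1)] j by simp
      then show "j \<in> \<tau> ` {..<k}" using i by auto
    next
      assume "j \<in> \<tau> ` {..<k}"
      then show "c j \<in> fst ` set \<sigma>" using \<tau>(2) by (auto simp: k_def)
    qed
    have "f x = f ?z" using agree[OF t] by (simp add: x_def)
    also have "\<dots> = (\<Sum>T\<in>low. monotone_term T ?z)" by (rule f_light[OF z])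
    also have "\<dots> = (\<Sum>T\<in>L. monotone_term T ?z)"
    proof (rule sum.mono_neutral_right)
      show "\<forall>T\<in>low - L. monotone_term T ?z = 0"
      proof
        fix T assume T: "T \<in> low - L"
        then obtain j where j: "j \<in> T" "j \<notin> \<tau> ` {..<k}" by (auto simp: L_def)
        then have "?z j = 0" using kept[of j] T by (auto simp: keep_def relevant_def)
        then show "monotone_term T ?z = 0"
          unfolding monotone_term_def using j(1) T finite_term
          by (intro prod_zero) (auto simp: low_def)
      qed
    qed (use finite_low in \<open>auto simp: L_def\<close>)
    also have "\<dots> = (\<Sum>T\<in>L. monotone_term (I T) (\<lambda>i. response f c (\<sigma> ! i) x))"
    proof (rule sum.cong[OF refl])
      fix T assume T: "T \<in> L"
      have "monotone_term T ?z = (\<Prod>j\<in>T. x j)"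
        unfolding monotone_term_def
      proof (intro prod.cong refl)
        fix j assume "j \<in> T"
        then have "j \<in> relevant" "j \<in> \<tau> ` {..<k}"
          using T by (auto simp: relevant_def L_def)
        then show "?z j = x j" using kept by (simp add: keep_def)
      qed
      also have "\<dots> = (\<Prod>i\<in>I T. x (\<tau> i))"
        using prod.reindex[OF inj\<tau>, of "\<lambda>j. x j" T] img[OF T] by simp
      also have "\<dots> = monotone_term (I T) (\<lambda>i. response f c (\<sigma> ! i) x)"
        unfolding monotone_term_def using \<tau>(3) by (intro prod.cong refl) (auto simp: I_def)
      finally show "monotone_term T ?z = monotone_term (I T) (\<lambda>i. response f c (\<sigma> ! i) x)" .
    qed
    also have "\<dots> = (\<Sum>J\<in>I ` L. monotone_term J (\<lambda>i. response f c (\<sigma> ! i) x))"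
      using sum.reindex[OF injI, of "\<lambda>J. monotone_term J (\<lambda>i. response f c (\<sigma> ! i) x)"] by simp
    finally show ?thesis by (simp add: x_def)
  qed
  ultimately show ?thesis
    unfolding accepts_def using test by (auto simp: k_def)
qed

text \<open>For a known block \<open>m\<close> the two points would coincide. For a new one, zeroing
  \<open>m\<close> in the first point gives exactly the second.\<close>

lemma valid_Cons:
  assumes val: "valid c \<sigma>" and x: "x \<in> cube n" "\<not> heavy x"
    and neq: "f (keep c (fst ` set \<sigma> \<union> {..<Suc m}) x) \<noteq> f (keep c (fst ` set \<sigma> \<union> {..<m}) x)"
  shows "valid c ((m, keep c (fst ` set \<sigma> \<union> {..<Suc m}) x) # \<sigma>)"
proof -
  let ?B = "fst ` set \<sigma>"
  have m: "m \<notin> ?B"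
  proof
    assume "m \<in> ?B"
    then have "?B \<union> {..<Suc m} = ?B \<union> {..<m}" by (auto simp: lessThan_Suc)
    then show False using neq by simp
  qed
  have "mix c m (keep c (?B \<union> {..<Suc m}) x) 0 = keep c (?B \<union> {..<m}) x"
    using m by (auto simp: mix_def keep_def less_Suc_eq)
  then have "witness c (m, keep c (?B \<union> {..<Suc m}) x)"
    using x heavy_mono keep_le neq by (auto simp: witness_def intro: keep_in_cube)
  then show ?thesis using val m by (auto simp: valid_def)
qed

text \<open>Within an epoch the only source of error is a heavy sample point. Without one, the run
  either accepts or passes to a valid state longer by one, which keeps
  \<open>length \<sigma> + e\<close> constant.\<close>

lemma prob_epochs_False_le:
  assumes inj: "inj_on c relevant" and c: "\<And>i. i < n \<Longrightarrow> c i < 2 ^ r"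
    and val: "valid c \<sigma>" and len: "length \<sigma> + e = Suc (s * r)"
  shows "measure_pmf.prob (run f (epochs n c r s N e \<sigma>)) {False} \<le> real e * (real N * (real s * (1/2) ^ r))"
  using val len
proof (induction e arbitrary: \<sigma>)
  case 0
  \<comment> \<open>With no epochs left, the state would have more than \<open>s * r\<close> blocks,
    so this case is void.\<close>
  then show ?case using length_valid_le[OF inj] by fastforce
next
  case (Suc e)
  let ?p = "replicate_pmf N (trial n)" and ?b = "real N * (real s * (1/2) ^ r)"
  have "measure_pmf.prob (run f (epochs n c r s N (Suc e) \<sigma>)) {False} \<le>
      measure_pmf.prob ?p {\<rho>. \<exists>t\<in>set \<rho>. t \<in> {t. heavy (fst t)}} + real e * ?b"
    unfolding epochs.simps run_Sample_map
  proof (rule prob_bind_le)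
    fix \<rho> assume \<rho>: "\<rho> \<in> set_pmf ?p" "\<rho> \<notin> {\<rho>. \<exists>t\<in>set \<rho>. t \<in> {t. heavy (fst t)}}"
    let ?A = "run f (epoch c r s \<sigma> \<rho> (epochs n c r s N e))"
    have cube: "fst t \<in> cube n" and light: "\<not> heavy (fst t)" if "t \<in> set \<rho>" for t
      using fst_trials_in_cube[OF \<rho>(1) that] \<rho>(2) that by auto
    show "measure_pmf.prob ?A {False} \<le> real e * ?b"
    proof (cases "\<forall>t\<in>set \<rho>. f (fst t) = f (keep c (fst ` set \<sigma>) (fst t))")
      case True
      then have "accepts f c r s \<sigma> \<rho>"
        using cube light by (intro accepts_valid[OF inj Suc.prems(1)]) auto
      then have "?A = return_pmf True"
        using True by (subst run_epoch_agree) auto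
      then show ?thesis by simp
    next
      case False
      then obtain t where t: "t \<in> set \<rho>" "f (fst t) \<noteq> f (keep c (fst ` set \<sigma>) (fst t))"
        by blast
      obtain t' m where t': "t' \<in> set \<rho>"
        "?A = run f (epochs n c r s N e ((m, keep c (fst ` set \<sigma> \<union> {..<Suc m}) (fst t')) # \<sigma>))"
        "keep c (fst ` set \<sigma> \<union> {..<2 ^ r}) (fst t') = fst t' \<Longrightarrow>
           f (keep c (fst ` set \<sigma> \<union> {..<Suc m}) (fst t')) \<noteq> f (keep c (fst ` set \<sigma> \<union> {..<m}) (fst t'))"
        using t by (rule run_epoch_disagree[where r = r and s = s and k = "epochs n c r s N e"]) blast
      \<comment> \<open>The blocks below \<open>2 ^ r\<close> cover all variables below
        \<open>n\<close>, and a point of the cube vanishes from \<open>n\<close> on.\<close>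
      have "keep c (fst ` set \<sigma> \<union> {..<2 ^ r}) (fst t') = fst t'"
      proof
        fix i
        show "keep c (fst ` set \<sigma> \<union> {..<2 ^ r}) (fst t') i = fst t' i"
          using c[of i] cube[OF t'(1)] by (cases "i < n") (auto simp: keep_def in_cube_iff)
      qed
      then have "valid c ((m, keep c (fst ` set \<sigma> \<union> {..<Suc m}) (fst t')) # \<sigma>)"
        using valid_Cons[OF Suc.prems(1) cube[OF t'(1)] light[OF t'(1)]] t'(3) by blast
      then show ?thesis
        unfolding t'(2) by (rule Suc.IH) (use Suc.prems in simp)
    qed
  qed simp
  also have "measure_pmf.prob ?p {\<rho>. \<exists>t\<in>set \<rho>. t \<in> {t. heavy (fst t)}} \<le> ?b"
  proof (rule order_trans[OF prob_replicate_ex])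
    have "measure_pmf.prob (trial n) {t. heavy (fst t)} \<le> real s * (1/2) ^ r"
      using prob_heavy_le prob_pair_fst[of "unif n" "pair_pmf (unif n) (unif n)" "{x. heavy x}"] by simp
    then show "real N * measure_pmf.prob (trial n) {t. heavy (fst t)} \<le> ?b"
      by (intro mult_left_mono) auto
  qed
  finally show ?case by (simp add: algebra_simps)
qed

end

section \<open>Choice of parameters\<close>

definition inv_eps :: "real \<Rightarrow> nat" where
  "inv_eps \<epsilon> = nat \<lceil>1 / \<epsilon>\<rceil>"

text \<open>For a positive product this is its binary logarithm, rounded up.\<close>

definition log_size :: "nat \<Rightarrow> real \<Rightarrow> nat" where
  "log_size s \<epsilon> = (LEAST l. s * inv_eps \<epsilon> \<le> 2 ^ l)"

text \<open>The width serves as degree bound for terms, as logarithm of the number of blocks, and as exponent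
  of the error probabilities. The number of trials depends on it in turn; the constants make
  \<open>2 ^ width\<close> exceed both the square of the number of blocks and the number of pairs of a sample
  point and a term, which are of order at most \<open>(2 ^ l * width) ^ 3\<close> for \<open>l = log_size\<close>.\<close>

definition width :: "nat \<Rightarrow> real \<Rightarrow> nat" where
  "width s \<epsilon> = 8 * log_size s \<epsilon> + 20"

text \<open>Bounds the number of relevant variables: \<open>s\<close> terms with at most
  \<open>width\<close> variables each.\<close>

definition max_blocks :: "nat \<Rightarrow> real \<Rightarrow> nat" where
  "max_blocks s \<epsilon> = s * width s \<epsilon>"

text \<open>A defect of probability \<open>\<epsilon> / (4 * max_blocks s \<epsilon>)\<close> is
  then missed with probability at most \<open>(1/2) ^ width\<close>. A defect of probability
  \<open>\<epsilon> / 2\<close> gets the exponent \<open>2 * max_blocks * width\<close>, enough to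
  outweigh the number of candidates.\<close>

definition num_trials :: "nat \<Rightarrow> real \<Rightarrow> nat" where
  "num_trials s \<epsilon> = 4 * max_blocks s \<epsilon> * inv_eps \<epsilon> * width s \<epsilon>"

text \<open>For \<open>\<epsilon> > 1\<close> nothing is far, and accepting without queries is
  correct. It also respects the bound, which tends to 0 as \<open>\<epsilon>\<close> grows.
  Otherwise there are \<open>2 ^ width\<close> blocks, so that a binary search takes
  \<open>width\<close> queries.\<close>

definition tester :: "nat \<Rightarrow> nat \<Rightarrow> real \<Rightarrow> query_alg" where
  "tester n s \<epsilon> =
     (if \<epsilon> > 1 then Output True
      else Sample (map_pmf
        (\<lambda>c. epochs n c (width s \<epsilon>) s (num_trials s \<epsilon>) (Suc (max_blocks s \<epsilon>)) [])
        (hash n (2 ^ width s \<epsilon>))))"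

definition queries :: "nat \<Rightarrow> real \<Rightarrow> nat" where
  "queries s \<epsilon> =
     (if \<epsilon> > 1 then 0
      else Suc (max_blocks s \<epsilon>) * (2 * num_trials s \<epsilon> + width s \<epsilon>) +
        max_blocks s \<epsilon> * (5 * num_trials s \<epsilon> + 1))"

section \<open>Numerical estimates and error bounds\<close>

text \<open>From \<open>l\<close> to \<open>Suc l\<close> the left side grows by a factor of at most
  8, the right side by 32. The summand 20 settles \<open>l = 0\<close>.\<close>

lemma cubic_le_exponential: "24 * (8 * l + 21) ^ 3 \<le> (2 :: nat) ^ (5 * l + 20)"
proof (induction l)
  case (Suc l)
  have "(8 * Suc l + 21) ^ 3 \<le> (2 * (8 * l + 21)) ^ 3"
    by (rule power_mono) auto
  also have "\<dots> = 8 * (8 * l + 21) ^ 3"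
    by (simp only: power_mult_distrib) simp
  finally have "24 * (8 * Suc l + 21) ^ 3 \<le> 8 * (24 * (8 * l + 21) ^ 3)"
    by simp
  also have "\<dots> \<le> 8 * 2 ^ (5 * l + 20)"
    using Suc by simp
  also have "\<dots> \<le> 2 ^ (5 * Suc l + 20)"
    by (simp add: power_add)
  finally show ?case .
qed simp

text \<open>By \<open>1 - x \<le> exp (- x)\<close> and \<open>2 \<le> exp 1\<close>.\<close>

lemma one_minus_power_le:
  fixes x :: real
  assumes "0 \<le> x" "x \<le> 1" "real m \<le> x * real N"
  shows "(1 - x) ^ N \<le> (1/2) ^ m"
proof -
  have "(1 - x) ^ N \<le> exp (- x) ^ N"
    using assms exp_ge_add_one_self[of "- x"] by (intro power_mono) auto
  also have "\<dots> = exp (- (x * real N))"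
    by (simp add: exp_of_nat_mult[symmetric] mult.commute)
  also have "\<dots> \<le> exp (- real m)"
    using assms(3) by simp
  also have "\<dots> = inverse (exp 1) ^ m"
    by (simp add: exp_minus power_inverse exp_of_nat_mult[symmetric])
  also have "\<dots> \<le> (1/2) ^ m"
    using exp_ge_add_one_self[of 1] by (intro power_mono) (auto simp: field_simps)
  finally show ?thesis .
qed

context
  fixes s :: nat and \<epsilon> :: real
  assumes s: "s \<ge> 1" and \<epsilon>: "0 < \<epsilon>" "\<epsilon> \<le> 1"
begin

lemma inv_eps_bounds: "1 \<le> inv_eps \<epsilon>" "1 \<le> \<epsilon> * inv_eps \<epsilon>" "real (inv_eps \<epsilon>) \<le> 2 / \<epsilon>"
proof -
  have pos: "1 \<le> 1 / \<epsilon>" using \<epsilon> by (simp add: field_simps)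
  then have eq: "real (inv_eps \<epsilon>) = of_int \<lceil>1 / \<epsilon>\<rceil>"
    unfolding inv_eps_def by simp
  have ge: "1 / \<epsilon> \<le> real (inv_eps \<epsilon>)"
    unfolding eq by (rule le_of_int_ceiling)
  then show "1 \<le> \<epsilon> * inv_eps \<epsilon>" using \<epsilon> by (simp add: field_simps)
  show "1 \<le> inv_eps \<epsilon>" using ge pos by linarith
  have "real (inv_eps \<epsilon>) \<le> 1 / \<epsilon> + 1" unfolding eq by linarith
  also have "\<dots> \<le> 2 / \<epsilon>" using \<epsilon> by (simp add: field_simps)
  finally show "real (inv_eps \<epsilon>) \<le> 2 / \<epsilon>" .
qed

lemma size_le_power: "s * inv_eps \<epsilon> \<le> 2 ^ log_size s \<epsilon>"
  unfolding log_size_def by (rule LeastI[of _ "s * inv_eps \<epsilon>"]) (simp add: less_imp_le)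

lemma power_log_size_le: "2 ^ log_size s \<epsilon> \<le> 2 * (s * inv_eps \<epsilon>)"
proof (cases "log_size s \<epsilon>")
  case 0
  then show ?thesis using s inv_eps_bounds(1) by simp
next
  case (Suc l)
  then have "\<not> s * inv_eps \<epsilon> \<le> 2 ^ l"
    using not_less_Least[of l "\<lambda>l. s * inv_eps \<epsilon> \<le> 2 ^ l"] by (simp add: log_size_def)
  then show ?thesis using Suc by simp
qed

lemma blocks_pos: "max_blocks s \<epsilon> \<ge> 8"
proof -
  have "1 * 20 \<le> s * width s \<epsilon>"
    using s by (intro mult_mono) (auto simp: width_def)
  then show ?thesis by (simp add: max_blocks_def)
qed

lemma s_le_power: "s \<le> 2 ^ log_size s \<epsilon>"
  using size_le_power inv_eps_bounds(1) by (metis dual_order.trans mult.commute mult_le_mono1 nat_mult_1)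

text \<open>Of the \<open>8 * log_size + 20\<close> in the exponent, \<open>3 * log_size\<close>
  pays for the cube of \<open>2 ^ log_size\<close> and the rest for the cube of
  \<open>Suc width\<close>.\<close>

lemma cube_width_le: "24 * ((2 ^ log_size s \<epsilon>) ^ 3 * Suc (width s \<epsilon>) ^ 3) \<le> 2 ^ width s \<epsilon>"
proof -
  have Suc_width: "Suc (width s \<epsilon>) = 8 * log_size s \<epsilon> + 21"
    by (simp add: width_def)
  have "24 * ((2 ^ log_size s \<epsilon>) ^ 3 * Suc (width s \<epsilon>) ^ 3) =
      (2 ^ log_size s \<epsilon>) ^ 3 * (24 * (8 * log_size s \<epsilon> + 21) ^ 3)"
    unfolding Suc_width by (simp only: mult_ac)
  also have "\<dots> \<le> (2 ^ log_size s \<epsilon>) ^ 3 * 2 ^ (5 * log_size s \<epsilon> + 20)"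
    by (intro mult_left_mono cubic_le_exponential) auto
  also have "\<dots> = 2 ^ width s \<epsilon>"
    by (simp add: width_def power_mult[symmetric] power_add[symmetric])
  finally show ?thesis .
qed

lemma Suc_blocks_le: "Suc (max_blocks s \<epsilon>) \<le> 2 ^ log_size s \<epsilon> * Suc (width s \<epsilon>)"
proof -
  have "max_blocks s \<epsilon> \<le> 2 ^ log_size s \<epsilon> * width s \<epsilon>"
    unfolding max_blocks_def using s_le_power by (rule mult_right_mono) simp
  moreover have "(1 :: nat) \<le> 2 ^ log_size s \<epsilon>"
    by simp
  ultimately show ?thesis
    unfolding mult_Suc_right by linarith
qed

text \<open>Keeps the total probability of heavy sample points, over all epochs, trials and long
  terms, below 1/6.\<close>

lemma width_ge_trials:
  "6 * (num_trials s \<epsilon> * s * Suc (max_blocks s \<epsilon>)) \<le> 2 ^ width s \<epsilon>"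
proof -
  let ?L = "2 ^ log_size s \<epsilon> :: nat" and ?r = "Suc (width s \<epsilon>)" and ?K = "Suc (max_blocks s \<epsilon>)"
  have "6 * (num_trials s \<epsilon> * s * ?K) =
      24 * ((s * inv_eps \<epsilon>) * (max_blocks s \<epsilon> * (width s \<epsilon> * ?K)))"
    by (simp del: mult_Suc mult_Suc_right add: num_trials_def)
  also have "\<dots> \<le> 24 * (?L * ((?L * ?r) * (?r * (?L * ?r))))"
    using size_le_power Suc_blocks_le by (intro mult_mono) auto
  also have "\<dots> = 24 * (?L ^ 3 * ?r ^ 3)"
    by (simp only: power3_eq_cube mult_ac)
  finally show ?thesis using cube_width_le by linarith
qed

text \<open>Serves the birthday bound for the hash and the soundness error; the summand 2 matches
  the base in the count of candidates.\<close>

lemma width_ge_blocks: "6 * (max_blocks s \<epsilon> + 2) ^ 2 \<le> 2 ^ width s \<epsilon>"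
proof -
  let ?L = "2 ^ log_size s \<epsilon> :: nat" and ?r = "Suc (width s \<epsilon>)"
  have "max_blocks s \<epsilon> + 2 \<le> 2 * Suc (max_blocks s \<epsilon>)" by simp
  also have "\<dots> \<le> 2 * (?L * ?r)" using Suc_blocks_le by (rule mult_left_mono) simp
  finally have "6 * (max_blocks s \<epsilon> + 2) ^ 2 \<le> 6 * (2 * (?L * ?r)) ^ 2"
    by (intro mult_left_mono power_mono) auto
  also have "\<dots> = 24 * (?L * ?r) ^ 2" by (simp only: power_mult_distrib) simp
  also have "\<dots> \<le> 24 * (?L * ?r) ^ 3"
  proof (rule mult_left_mono[OF power_increasing])
    show "1 \<le> ?L * ?r" using Suc_blocks_le by linarith
  qed simp_all
  also have "\<dots> = 24 * (?L ^ 3 * ?r ^ 3)" by (simp only: power_mult_distrib)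
  finally show ?thesis using cube_width_le by linarith
qed

text \<open>In each epoch a failing coordinate test contributes at most \<open>K / 2 ^ r\<close> and
  the candidates at most \<open>1 / 2 ^ r\<close>. Over \<open>Suc K\<close> epochs this is at most
  \<open>(K + 2) ^ 2 / 2 ^ r\<close>, which \<open>width_ge_blocks\<close> bounds by 1/6.\<close>

lemma sound_error_le:
  "real (Suc (max_blocks s \<epsilon>)) *
    (real (max_blocks s \<epsilon>) * (1 - \<epsilon> / (4 * max_blocks s \<epsilon>)) ^ num_trials s \<epsilon> +
     real ((max_blocks s \<epsilon> + 2) ^ (width s \<epsilon> * s)) * (1 - \<epsilon> / 2) ^ num_trials s \<epsilon>) \<le> 1/3"
proof -
  define K where "K = max_blocks s \<epsilon>"
  define r where "r = width s \<epsilon>"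
  define N where "N = num_trials s \<epsilon>"
  define E where "E = inv_eps \<epsilon>"
  have N: "real N = 4 * real K * real E * real r"
    by (simp add: N_def num_trials_def K_def r_def E_def)
  have K: "K \<ge> 8" using blocks_pos by (simp add: K_def)
  have E: "1 \<le> \<epsilon> * real E" using inv_eps_bounds by (simp add: E_def)
  have rE: "real r \<le> \<epsilon> * real E * real r"
    using mult_right_mono[OF E, of "real r"] by simp
  have blocks: "6 * real ((K + 2) ^ 2) \<le> 2 ^ r"
    using of_nat_mono[OF width_ge_blocks, where 'a = real] unfolding K_def r_def by simp
  have "(1 - \<epsilon> / (4 * K)) ^ N \<le> (1/2) ^ r"
    using \<epsilon> K rE by (intro one_minus_power_le) (auto simp: N field_simps)
  then have "real K * (1 - \<epsilon> / (4 * K)) ^ N \<le> real K * (1/2) ^ r"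
    by (rule mult_left_mono) simp
  moreover have "real ((K + 2) ^ (r * s)) * (1 - \<epsilon> / 2) ^ N \<le> 1 * (1/2) ^ r"
  proof -
    have "real (2 * K * r) = 2 * real K * real r" by simp
    also have "\<dots> \<le> 2 * real K * (\<epsilon> * real E * real r)"
      using rE by (rule mult_left_mono) simp
    also have "\<dots> = \<epsilon> / 2 * real N" by (simp add: N)
    finally have "(1 - \<epsilon> / 2) ^ N \<le> (1/2) ^ (2 * K * r)"
      using \<epsilon> by (intro one_minus_power_le) auto
    \<comment> \<open>One half of the exponent cancels the number of candidates, which is at most
      \<open>2 ^ (r * K)\<close>; the other half is at least \<open>r\<close>.\<close>
    also have "2 * K * r = r * K + r * K"
      by simp
    also have "(1/2 :: real) ^ (r * K + r * K) = (1/2) ^ (r * K) * (1/2) ^ (r * K)"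
      by (rule power_add)
    also have "\<dots> \<le> (1/2) ^ (r * K) * (1/2) ^ r"
      using K by (intro mult_left_mono power_decreasing) auto
    finally have 1: "(1 - \<epsilon> / 2) ^ N \<le> (1/2) ^ (r * K) * (1/2) ^ r" .
    have "K + 2 \<le> (K + 2) ^ 2" by (simp add: power2_eq_square)
    then have "real (K + 2) \<le> 2 ^ r" using blocks by linarith
    then have "real (K + 2) ^ K \<le> (2 ^ r) ^ K" by (rule power_mono) simp
    moreover have "r * s = K" by (simp add: K_def r_def max_blocks_def)
    ultimately have "real ((K + 2) ^ (r * s)) \<le> 2 ^ (r * K)" by (simp add: power_mult)
    then have "real ((K + 2) ^ (r * s)) * (1 - \<epsilon> / 2) ^ N \<le> 2 ^ (r * K) * ((1/2) ^ (r * K) * (1/2) ^ r)"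
      using 1 \<epsilon> by (intro mult_mono) auto
    also have "\<dots> = (2 * (1/2)) ^ (r * K) * (1/2) ^ r"
      by (simp only: power_mult_distrib mult.assoc)
    finally show ?thesis by simp
  qed
  ultimately have "real K * (1 - \<epsilon> / (4 * K)) ^ N + real ((K + 2) ^ (r * s)) * (1 - \<epsilon> / 2) ^ N \<le>
      real K * (1/2) ^ r + 1 * (1/2) ^ r"
    by (rule add_mono)
  also have "\<dots> = real (Suc K) / 2 ^ r"
    by (simp add: field_simps power_one_over)
  finally have "real (Suc K) * (real K * (1 - \<epsilon> / (4 * K)) ^ N + real ((K + 2) ^ (r * s)) * (1 - \<epsilon> / 2) ^ N) \<le>
      real (Suc K) * (real (Suc K) / 2 ^ r)"
    by (rule mult_left_mono) simp
  also have "\<dots> = real (Suc K ^ 2) / 2 ^ r"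
    by (simp only: power2_eq_square of_nat_mult times_divide_eq_right)
  also have "\<dots> \<le> real ((K + 2) ^ 2) / 2 ^ r"
    by (intro divide_right_mono of_nat_mono power_mono) auto
  also have "\<dots> \<le> 1/6" using blocks by (simp add: field_simps)
  finally show ?thesis unfolding K_def r_def N_def by simp
qed

lemma run_tester:
  "run f (tester n s \<epsilon>) = bind_pmf (hash n (2 ^ width s \<epsilon>))
     (\<lambda>c. run f (epochs n c (width s \<epsilon>) s (num_trials s \<epsilon>) (Suc (max_blocks s \<epsilon>)) []))"
  using \<epsilon> unfolding tester_def by (simp del: epochs.simps run.simps add: run_Sample_map)

lemma tester_rejects:
  assumes far: "eps_far n \<epsilon> (sparse_polynomial n s) f"
  shows "measure_pmf.prob (run f (tester n s \<epsilon>)) {True} \<le> 1/3"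
proof -
  let ?K = "max_blocks s \<epsilon>" and ?r = "width s \<epsilon>" and ?N = "num_trials s \<epsilon>"
  let ?b = "real ?K * (1 - \<epsilon> / (4 * ?K)) ^ ?N + real ((?K + 2) ^ (?r * s)) * (1 - \<epsilon> / 2) ^ ?N"
  have b: "0 \<le> ?b"
    using \<epsilon> blocks_pos by (intro add_nonneg_nonneg mult_nonneg_nonneg zero_le_power) (auto simp: field_simps)
  have "measure_pmf.prob (run f (epochs n c ?r s ?N (Suc ?K) [])) {True} \<le> 1/3" for c
  proof -
    have "measure_pmf.prob (run f (epochs n c ?r s ?N (Suc ?K) [])) {True} \<le> real (Suc ?K) * ?b"
    proof (rule prob_epochs_True_le)
      show "measure_pmf.prob (replicate_pmf ?N (trial n)) {\<rho>. accepts f c ?r s \<sigma> \<rho>} \<le> ?b"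
        if "length \<sigma> \<le> ?K" for \<sigma>
        using \<epsilon> that blocks_pos by (intro prob_accepts_le far) (auto simp: width_def)
    qed (use b in auto)
    then show ?thesis using sound_error_le by linarith
  qed
  then have "measure_pmf.prob (run f (tester n s \<epsilon>)) {True} \<le>
      measure_pmf.prob (hash n (2 ^ ?r)) {} + 1/3"
    unfolding run_tester by (rule prob_bind_le) simp
  then show ?thesis by simp
qed

text \<open>Two sources of error, at most 1/6 each: relevant variables that share a block, and heavy
  sample points.\<close>

lemma tester_accepts:
  assumes "f \<in> sparse_polynomial n s"
  shows "measure_pmf.prob (run f (tester n s \<epsilon>)) {False} \<le> 1/3"
proof -
  let ?K = "max_blocks s \<epsilon>" and ?r = "width s \<epsilon>" and ?N = "num_trials s \<epsilon>"
  obtain M where M: "M \<subseteq> Pow {..<n}" "card M \<le> s" "\<And>x. x \<in> cube n \<Longrightarrow> f x = (\<Sum>T\<in>M. monotone_term T x)"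
    using assms unfolding sparse_polynomial_def by blast
  interpret sparse_target n s ?r f M
    by unfold_locales (use M in auto)
  let ?b = "real (Suc ?K) * (real ?N * (real s * (1/2) ^ ?r))"
  have "measure_pmf.prob (run f (tester n s \<epsilon>)) {False} \<le>
      measure_pmf.prob (hash n (2 ^ ?r)) {c. \<not> inj_on c relevant} + ?b"
    unfolding run_tester
  proof (rule prob_bind_le)
    fix c assume "c \<in> set_pmf (hash n (2 ^ ?r))" "c \<notin> {c. \<not> inj_on c relevant}"
    then show "measure_pmf.prob (run f (epochs n c ?r s ?N (Suc ?K) [])) {False} \<le> ?b"
      by (intro prob_epochs_False_le) (auto simp: valid_def max_blocks_def intro: hash_range)
  qed simp
  also have "measure_pmf.prob (hash n (2 ^ ?r)) {c. \<not> inj_on c relevant} \<le> 1/6"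
  proof -
    have "measure_pmf.prob (hash n (2 ^ ?r)) {c. \<not> inj_on c relevant} \<le>
        real (card relevant ^ 2) * (1 / real (2 ^ ?r))"
      by (rule prob_hash_not_inj_le[OF relevant_sub]) simp
    also have "\<dots> \<le> real ((?K + 2) ^ 2) * (1 / real (2 ^ ?r))"
      using card_relevant by (intro mult_right_mono of_nat_mono power_mono) (auto simp: max_blocks_def)
    also have "\<dots> \<le> 1/6"
      using of_nat_mono[OF width_ge_blocks, where 'a = real] by (simp add: field_simps)
    finally show ?thesis .
  qed
  also have "?b = real (?N * s * Suc ?K) / 2 ^ ?r"
    by (simp add: power_one_over field_simps)
  also have "\<dots> \<le> 1/6"
    using of_nat_mono[OF width_ge_trials, where 'a = real] by (simp add: field_simps)
  finally show ?thesis by simp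
qed

section \<open>The query bound and the final assembly\<close>

text \<open>The count is dominated by products of \<open>max_blocks\<close> and
  \<open>num_trials\<close>. These contain \<open>width\<close> three times, and
  \<open>width\<close> is linear in the logarithm of \<open>s / \<epsilon>\<close>, which is at most
  that of \<open>T\<close>.\<close>

lemma queries_le: "real (queries s \<epsilon>) \<le> 96 * 36 ^ 3 * ((real s)\<^sup>2 / \<epsilon>) * (1 + \<bar>ln ((real s)\<^sup>2 / \<epsilon>)\<bar>) ^ 3"
proof -
  let ?K = "max_blocks s \<epsilon>" and ?r = "width s \<epsilon>" and ?N = "num_trials s \<epsilon>" and ?E = "inv_eps \<epsilon>"
  define T where "T = (real s)\<^sup>2 / \<epsilon>"
  have "1 * 1 * 1 * ?r \<le> 4 * ?K * ?E * ?r"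
    using blocks_pos inv_eps_bounds(1) by (intro mult_mono) auto
  then have rN: "?r \<le> ?N" by (simp add: num_trials_def)
  have r1: "1 \<le> ?r" by (simp add: width_def)
  have "queries s \<epsilon> = Suc ?K * (2 * ?N + ?r) + ?K * (5 * ?N + 1)"
    using \<epsilon> by (simp add: queries_def)
  also have "\<dots> \<le> (2 * ?K) * (3 * ?N) + ?K * (6 * ?N)"
    using blocks_pos rN r1 by (intro add_mono mult_mono) auto
  also have "\<dots> = 48 * s ^ 2 * ?r ^ 3 * ?E"
    by (simp add: num_trials_def max_blocks_def power2_eq_square power3_eq_cube)
  finally have "real (queries s \<epsilon>) \<le> real (48 * s ^ 2 * ?r ^ 3 * ?E)"
    by (rule of_nat_mono)
  also have "\<dots> = 48 * (real s)\<^sup>2 * real ?r ^ 3 * real ?E" by simp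
  also have "\<dots> \<le> 48 * (real s)\<^sup>2 * real ?r ^ 3 * (2 / \<epsilon>)"
    by (intro mult_left_mono inv_eps_bounds) auto
  also have "\<dots> = 96 * T * real ?r ^ 3" by (simp add: T_def)
  also have "\<dots> \<le> 96 * T * (36 * (1 + \<bar>ln T\<bar>)) ^ 3"
  proof (intro mult_left_mono power_mono)
    have T1: "1 \<le> T"
      using s \<epsilon> by (auto simp: T_def field_simps intro: order_trans[OF _ one_le_power])
    have "real s * 1 \<le> real s * real s" using s by (intro mult_left_mono) auto
    have "(2 :: real) ^ log_size s \<epsilon> \<le> 2 * (real s * real ?E)"
      using of_nat_mono[OF power_log_size_le, where 'a = real] by simp
    also have "\<dots> \<le> 2 * (real s * real s * (2 / \<epsilon>))"
      using \<open>real s * 1 \<le> real s * real s\<close> inv_eps_bounds(3) by (intro mult_left_mono mult_mono) auto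
    also have "\<dots> = 4 * T" by (simp add: T_def power2_eq_square)
    finally have "ln ((2 :: real) ^ log_size s \<epsilon>) \<le> ln (4 * T)"
      using T1 by (subst ln_le_cancel_iff) auto
    moreover have "ln ((2 :: real) ^ log_size s \<epsilon>) = real (log_size s \<epsilon>) * ln 2"
      by (rule ln_realpow)
    moreover have "ln (4 * T) = 2 * ln 2 + ln T"
      using T1 ln_realpow[of 2 2] by (simp add: ln_mult)
    ultimately have "real (log_size s \<epsilon>) * ln 2 \<le> 2 * ln 2 + ln T" by simp
    \<comment> \<open>As \<open>ln 2\<close> is at least 1/2, it can be factored out of the whole
      bound and cancelled.\<close>
    moreover have "ln T \<le> 2 * ln T * ln 2"
      using mult_left_mono[of "1/2" "ln 2" "2 * ln T"] ln2_ge_two_thirds T1 by simp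
    ultimately have "real (log_size s \<epsilon>) * ln 2 \<le> (2 + 2 * ln T) * ln 2"
      by (simp add: algebra_simps)
    then have "real (log_size s \<epsilon>) \<le> 2 + 2 * ln T" by simp
    then have "real ?r \<le> 36 + 16 * ln T" by (simp add: width_def)
    also have "\<dots> \<le> 36 * (1 + \<bar>ln T\<bar>)" using T1 by simp
    finally show "real ?r \<le> 36 * (1 + \<bar>ln T\<bar>)" .
  qed (use \<epsilon> in \<open>auto simp: T_def\<close>)
  also have "\<dots> = 96 * 36 ^ 3 * T * (1 + \<bar>ln T\<bar>) ^ 3"
    by (simp only: power_mult_distrib mult_ac)
  finally show ?thesis by (simp only: T_def)
qed

end

lemma prob_True_False: "pmf p True + pmf p False = 1"
  using sum_pmf_eq_1[OF finite subset_UNIV, of p] by (simp add: UNIV_bool)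

lemma eps_tester_tester:
  assumes s: "s \<ge> 1" and \<epsilon>: "\<epsilon> > 0"
  shows "eps_tester n \<epsilon> (sparse_polynomial n s) (tester n s \<epsilon>)"
proof (cases "\<epsilon> > 1")
  case True
  \<comment> \<open>No function is farther than 1 from the empty sum.\<close>
  have zero: "(\<lambda>_. 0) \<in> sparse_polynomial n s"
    by (auto simp: sparse_polynomial_def intro!: exI[of _ "{}"])
  have "\<not> eps_far n \<epsilon> (sparse_polynomial n s) f" for f
  proof
    assume "eps_far n \<epsilon> (sparse_polynomial n s) f"
    then have "\<epsilon> \<le> measure_pmf.prob (unif n) {x. f x \<noteq> (\<lambda>_. 0) x}"
      unfolding eps_far_def by (rule bspec[OF _ zero])
    also have "\<dots> \<le> 1" by simp
    finally show False using True by simp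
  qed
  then show ?thesis using True by (simp add: eps_tester_def tester_def)
next
  case False
  then have \<epsilon>1: "\<epsilon> \<le> 1" by simp
  show ?thesis
    unfolding eps_tester_def
  proof (intro allI conjI impI)
    fix f assume "f \<in> sparse_polynomial n s"
    then show "pmf (run f (tester n s \<epsilon>)) True \<ge> 2/3"
      using tester_accepts[OF s \<epsilon> \<epsilon>1, of f n] prob_True_False[of "run f (tester n s \<epsilon>)"]
      by (simp add: measure_pmf_single)
  next
    fix f assume "eps_far n \<epsilon> (sparse_polynomial n s) f"
    then show "pmf (run f (tester n s \<epsilon>)) False \<ge> 2/3"
      using tester_rejects[OF s \<epsilon> \<epsilon>1, of n f] prob_True_False[of "run f (tester n s \<epsilon>)"]
      by (simp add: measure_pmf_single)
  qed
qed

lemma query_bound_tester: "query_bound n (queries s \<epsilon>) (tester n s \<epsilon>)"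
proof (cases "\<epsilon> > 1")
  case False
  have "query_bound n (queries s \<epsilon>)
      (epochs n c (width s \<epsilon>) s (num_trials s \<epsilon>) (Suc (max_blocks s \<epsilon>)) [])" for c
    using query_bound_epochs[of "[]" n "Suc (max_blocks s \<epsilon>)" "max_blocks s \<epsilon>"] False
    by (simp del: epochs.simps add: queries_def)
  then show ?thesis
    using False by (auto simp: tester_def simp del: epochs.simps intro!: query_bound.intros(3))
qed (auto simp: tester_def intro: query_bound.intros)

theorem theorem20:
  shows "\<exists>(A :: nat \<Rightarrow> nat \<Rightarrow> real \<Rightarrow> query_alg) (q :: nat \<Rightarrow> real \<Rightarrow> nat).
    (\<forall>n s \<epsilon>. s \<ge> 1 \<longrightarrow> \<epsilon> > 0 \<longrightarrow>
       eps_tester n \<epsilon> (sparse_polynomial n s) (A n s \<epsilon>) \<and> query_bound n (q s \<epsilon>) (A n s \<epsilon>)) \<and>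
    soft_O_on {(s, \<epsilon>). s \<ge> 1 \<and> \<epsilon> > 0} (\<lambda>(s, \<epsilon>). real (q s \<epsilon>)) (\<lambda>(s, \<epsilon>). (real s)\<^sup>2 / \<epsilon>)"
proof (intro exI[of _ tester] exI[of _ queries] conjI allI impI)
  have "real (queries s \<epsilon>) \<le> 96 * 36 ^ 3 * ((real s)\<^sup>2 / \<epsilon>) * (1 + \<bar>ln ((real s)\<^sup>2 / \<epsilon>)\<bar>) ^ 3"
    if "s \<ge> 1" "\<epsilon> > 0" for s \<epsilon>
  proof (cases "\<epsilon> \<le> 1")
    case True
    then show ?thesis using queries_le that by blast
  next
    case False
    then show ?thesis using that by (simp add: queries_def)
  qed
  then show "soft_O_on {(s, \<epsilon>). s \<ge> 1 \<and> \<epsilon> > 0} (\<lambda>(s, \<epsilon>). real (queries s \<epsilon>)) (\<lambda>(s, \<epsilon>). (real s)\<^sup>2 / \<epsilon>)"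
    unfolding soft_O_on_def by (intro exI[of _ "96 * 36 ^ 3"] exI[of _ 3]) auto
qed (auto intro: eps_tester_tester query_bound_tester)

end
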